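(* Let $f:\mathbb{N}\to\mathbb{R}^{+}$ be a function such that $W(f)\neq\emptyset$. Then: (1) the Hausdorff dimension of $C(f)$ is equal to $E_W(f)/\log q$; (2) the upper box dimension of $C(f)$ is equal to $E_W(f)/\log q$, and the Hausdorff measure of dimension $E_W(f)/\log q$ of $C(f)$ is positive (or infinite); (3) there exists $x\in C(f)$ such that the closure of the orbit $\{\psi^k(x):k\in\mathbb{N}\}$ of $x$ under $\psi$ has positive (or infinite) Hausdorff measure of dimension $E_W(f)/\log q$.
   Context: Here $\mathbb{N}=\{0,1,2,\dots\}$, $\log$ is the natural logarithm, $q\ge2$ is a fixed integer and $A=\{0,1,\dots,q-1\}$. For an infinite word $w\in A^{\mathbb{N}}$, $p_w(n)$ is the number of distinct words of length $n$ that are factors (contiguous subwords) of $w$, and $E(w)=\lim_{n\to\infty}\frac1n\log p_w(n)$ (the limit always exists). For $f:\mathbb{N}\to\mathbb{R}^+$, $W(f)=\{w\in A^{\mathbb{N}}:p_w(n)\le f(n)\ \text{for all } n\in\mathbb{N}\}$ and the word entropy of $f$ is $E_W(f)=\sup_{w\in W(f)}E(w)$. For $x\in[0,1]$, $\mathbf{w}(x)=w_0w_1w_2\cdots\in A^{\mathbb{N}}$ is the word of digits of the base-$q$ representation $x=\sum_{i\ge0}w_i/q^{i+1}$; when $x$ is a $q$-adic rational with two representations, the one ending with $0^\infty$ is chosen (for $x=1$ the only representation is $(q-1)^\infty$). The set $C(f)$ is $\{x\in[0,1]:\mathbf{w}(x)\in W(f)\}$. The map $\psi:[0,1]\to[0,1]$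 is $\psi(x)=qx-\lfloor qx\rfloor$. *)

theory Defs
  imports "HOL-Analysis.Analysis"
begin

section \<open>Words and word entropy\<close>

definition alphabet :: "nat \<Rightarrow> nat set" where
  "alphabet q = {0..<q}"

definition factors :: "(nat \<Rightarrow> 'a) \<Rightarrow> nat \<Rightarrow> 'a list set" where
  "factors w n = {map w [i..<i + n] | i. True}"

definition complexity :: "(nat \<Rightarrow> 'a) \<Rightarrow> nat \<Rightarrow> nat" where
  "complexity w n = card (factors w n)"

(* The limit exists for words over a finite alphabet; the term at n = 0 is irrelevant. *)
definition entropy :: "(nat \<Rightarrow> 'a) \<Rightarrow> real" where
  "entropy w = lim (\<lambda>n. 1 / real n * ln (real (complexity w n)))"

definition W :: "nat \<Rightarrow> (nat \<Rightarrow> real) \<Rightarrow> (nat \<Rightarrow> nat) set" where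
  "W q f = {w. range w \<subseteq> alphabet q \<and> (\<forall>n. real (complexity w n) \<le> f n)}"

(* A supremum of reals; it is only meaningful when W q f is nonempty. The values are
   bounded above by ln q. *)
definition word_entropy :: "nat \<Rightarrow> (nat \<Rightarrow> real) \<Rightarrow> real" where
  "word_entropy q f = (SUP w\<in>W q f. entropy w)"

section \<open>Base-q representations\<close>

definition represents :: "nat \<Rightarrow> (nat \<Rightarrow> nat) \<Rightarrow> real \<Rightarrow> bool" where
  "represents q w x \<longleftrightarrow>
     range w \<subseteq> alphabet q \<and> (\<lambda>i. real (w i) / real q ^ (i + 1)) sums x"

(* Every x in [0,1] has one or two representations. If there are two, exactly one of them
   ends with zeros and the second conjunct selects it; if there is only one, as for
   x = 1, the second conjunct is vacuous. *)
definition digit_word :: "nat \<Rightarrow> real \<Rightarrow> nat \<Rightarrow> nat" where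
  "digit_word q x = (THE w. represents q w x \<and>
     ((\<exists>v. represents q v x \<and> v \<noteq> w) \<longrightarrow> (\<exists>N. \<forall>i\<ge>N. w i = 0)))"

definition C :: "nat \<Rightarrow> (nat \<Rightarrow> real) \<Rightarrow> real set" where
  "C q f = {x \<in> {0..1}. digit_word q x \<in> W q f}"

definition psi :: "nat \<Rightarrow> real \<Rightarrow> real" where
  "psi q x = real q * x - of_int \<lfloor>real q * x\<rfloor>"

section \<open>Hausdorff measure and dimension, upper box dimension\<close>

(* The s-th power of the diameter with the usual conventions: the empty set contributes 0 for
   every s, and a nonempty set contributes 1 for s = 0. (In contrast, 0 powr 0 = 0.) *)
definition diam_power :: "real \<Rightarrow> 'a::metric_space set \<Rightarrow> ennreal" where
  "diam_power s U = (if U = {} then 0 else if s = 0 then 1 else ennreal (diameter U powr s))"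

(* Boundedness is required because diameter is unspecified on unbounded sets. Finite covers
   are included, since the U i may be empty. *)
definition hausdorff_premeasure :: "real \<Rightarrow> real \<Rightarrow> 'a::metric_space set \<Rightarrow> ennreal" where
  "hausdorff_premeasure s \<delta> A =
     (INF U \<in> {U :: nat \<Rightarrow> 'a set. A \<subseteq> (\<Union>i. U i) \<and> (\<forall>i. bounded (U i) \<and> diameter (U i) \<le> \<delta>)}.
        \<Sum>i. diam_power s (U i))"

(* The premeasure increases as \<delta> decreases, so the supremum is the limit as \<delta> tends to 0. *)
definition hausdorff_measure :: "real \<Rightarrow> 'a::metric_space set \<Rightarrow> ennreal" where
  "hausdorff_measure s A = (SUP \<delta>\<in>{0<..}. hausdorff_premeasure s \<delta> A)"

definition hausdorff_dim :: "'a::metric_space set \<Rightarrow> ereal" where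
  "hausdorff_dim A = Inf {ereal s | s. 0 \<le> s \<and> hausdorff_measure s A = 0}"

(* Intended for totally bounded A, where a finite cover exists for every \<delta> > 0. *)
definition covering_number :: "real \<Rightarrow> 'a::metric_space set \<Rightarrow> nat" where
  "covering_number \<delta> A =
     (LEAST n. \<exists>F. finite F \<and> card F = n \<and> A \<subseteq> \<Union>F \<and> (\<forall>U\<in>F. bounded U \<and> diameter U \<le> \<delta>))"

definition upper_box_dim :: "'a::metric_space set \<Rightarrow> ereal" where
  "upper_box_dim A =
     Limsup (at_right 0) (\<lambda>\<delta>. ereal (ln (real (covering_number \<delta> A)) / - ln \<delta>))"

end

theory Submission
  imports Defs
begin

text \<open>
A violation of the bound \<open>f\<close> is visible in a finite part of a word, and shifting a word creates no
new factors; so \<open>W q f\<close> is a compact subshift of the full shift on \<open>q\<close> symbols. Let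
\<open>a\<^sub>n\<close> be the number of words of length \<open>n\<close> occurring in it. The sequence
\<open>ln a\<^sub>n\<close> is subadditive, so \<open>ln a\<^sub>n / n\<close> converges to its infimum \<open>h\<close>, and
\<open>a\<^sub>n \<ge> exp (n * h)\<close> for every \<open>n\<close>. Put \<open>s = h / ln q\<close>.

Upper bounds: numbers whose expansions share a prefix of length \<open>n\<close> lie within \<open>1 / q ^ n\<close> of
each other, so \<open>a\<^sub>n\<close> sets of this diameter cover \<open>C q f\<close>. The upper box dimension is therefore
at most \<open>s\<close>, and it dominates the Hausdorff dimension.

Lower bounds rest on Furstenberg's observation (\<open>cover_weight_ge_1\<close>): if the cylinders \<open>[u]\<close>
of finitely many words \<open>u \<in> V\<close> cover a compact subshift with \<open>a\<^sub>n \<ge> exp (n * h)\<close>, then the sum of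
\<open>exp (- h * |u|)\<close> over \<open>V\<close> is at least 1. Otherwise every point could be parsed into words of
\<open>V\<close>, and the number of prefixes would grow strictly more slowly than \<open>exp (n * h)\<close>. Since a set of
real numbers of diameter about \<open>1 / q ^ n\<close> meets only a bounded number of intervals belonging to
cylinders of length \<open>n\<close>, the values of such a subshift have positive \<open>s\<close>-dimensional Hausdorff
measure (\<open>premeasure_lower_bound\<close>).

It remains to see that \<open>h\<close> is the word entropy, that is, that some single word \<open>w\<close> in the subshift
has entropy \<open>h\<close> (\<open>ex_maximal_complexity\<close>). If no word had, every word would for some \<open>n\<close> have
fewer than \<open>exp (n * h)\<close> factors of length \<open>n\<close>. The words whose factors of length \<open>n\<close> lie in a
given set of fewer than \<open>exp (n * h)\<close> words are concatenations of these, and can be covered by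
cylinders of arbitrarily small total weight. As there are only countably many such sets, the whole
subshift would have covers of arbitrarily small weight, which is impossible. The same word proves the
last claim: its orbit closure is a subshift whose language has at least \<open>exp (n * h)\<close> words of every
length \<open>n\<close>, and the values of the shifts of \<open>w\<close> are the orbit of the value of \<open>w\<close> under
\<open>psi q\<close>.

Passing between words and numbers neglects the words that end with the digit \<open>q - 1\<close>. They are
countably many, hence negligible if \<open>h > 0\<close>; if \<open>h = 0\<close>, the exponent is 0 and the constant word
with digit 0 is a witness for every claim.
\<close>

section \<open>Languages of one-sided subshifts\<close>

definition full_shift :: "nat \<Rightarrow> (nat \<Rightarrow> nat) set" where
  "full_shift q = {w. range w \<subseteq> alphabet q}"

definition shift_invariant :: "(nat \<Rightarrow> 'a) set \<Rightarrow> bool" where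
  "shift_invariant X \<longleftrightarrow> (\<forall>w\<in>X. (\<lambda>j. w (Suc j)) \<in> X)"

definition shift_orbit :: "(nat \<Rightarrow> 'a) \<Rightarrow> (nat \<Rightarrow> 'a) set" where
  "shift_orbit w = range (\<lambda>k j. w (j + k))"

definition prefixes :: "(nat \<Rightarrow> 'a) set \<Rightarrow> nat \<Rightarrow> 'a list set" where
  "prefixes X n = (\<lambda>w. map w [0..<n]) ` X"

definition cylinder :: "'a list \<Rightarrow> (nat \<Rightarrow> 'a) set" where
  "cylinder u = {w. map w [0..<length u] = u}"

lemma mem_cylinder: "w \<in> cylinder u \<longleftrightarrow> (\<forall>i<length u. w i = u ! i)"
  unfolding cylinder_def mem_Collect_eq by (subst list_eq_iff_nth_eq) simp

lemma shift_invariantD: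
  assumes "shift_invariant X" "w \<in> X"
  shows "(\<lambda>j. w (j + k)) \<in> X"
proof (induction k)
  case (Suc k)
  then have "(\<lambda>j. w (Suc j + k)) \<in> X"
    using assms(1) unfolding shift_invariant_def by (rule bspec[rotated])
  then show ?case by simp
qed (use assms in simp)

lemma map_upt_add:
  "map w [0..<m + n] = map w [0..<m] @ map (\<lambda>j. w (j + m)) [0..<n]"
  by (rule nth_equalityI) (auto simp: nth_append)

lemma map_shift_upt: "map (\<lambda>j. w (j + i)) [0..<n] = map w [i..<i + n]"
  by (rule nth_equalityI) (auto simp: add.commute)

lemma factors_eq_prefixes: "factors w n = prefixes (shift_orbit w) n"
  unfolding factors_def prefixes_def shift_orbit_def image_image map_shift_upt by auto

lemma factors_shift_subset: "factors (\<lambda>j. w (Suc j)) n \<subseteq> factors w n"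
proof -
  have "map (\<lambda>j. w (Suc j)) [i..<i + n] = map w [Suc i..<Suc i + n]" for i
    by (rule nth_equalityI) (auto simp del: upt_Suc)
  then show ?thesis unfolding factors_def by blast
qed

lemma shift_invariant_orbit: "shift_invariant (shift_orbit w)"
  unfolding shift_invariant_def shift_orbit_def
proof (clarify)
  fix k
  show "(\<lambda>j. w (Suc j + k)) \<in> range (\<lambda>k j. w (j + k))"
    by (rule range_eqI[of _ _ "Suc k"]) simp
qed

lemma shift_in_full_shift: "w \<in> full_shift q \<Longrightarrow> (\<lambda>j. w (j + k)) \<in> full_shift q"
  unfolding full_shift_def by auto

lemma shift_orbit_subset: "shift_invariant X \<Longrightarrow> w \<in> X \<Longrightarrow> shift_orbit w \<subseteq> X"
  unfolding shift_orbit_def using shift_invariantD by fastforce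

lemma prefixes_mono: "X \<subseteq> Y \<Longrightarrow> prefixes X n \<subseteq> prefixes Y n"
  unfolding prefixes_def by auto

lemma finite_prefixes:
  assumes "X \<subseteq> full_shift q"
  shows "finite (prefixes X n)"
proof (rule finite_subset)
  show "prefixes X n \<subseteq> {xs. set xs \<subseteq> alphabet q \<and> length xs = n}"
    using assms unfolding prefixes_def full_shift_def by (auto simp: image_subset_iff subset_iff)
  show "finite {xs. set xs \<subseteq> alphabet q \<and> length xs = n}"
    by (intro finite_lists_length_eq) (simp add: alphabet_def)
qed

lemma finite_factors:
  assumes "w \<in> full_shift q"
  shows "finite (factors w n)"
  unfolding factors_eq_prefixes using assms
  by (intro finite_prefixes[of _ q]) (auto simp: shift_orbit_def shift_in_full_shift)

lemma prefixes_add: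
  assumes "shift_invariant X"
  shows "prefixes X (m + n) \<subseteq> (\<lambda>(u, v). u @ v) ` (prefixes X m \<times> prefixes X n)"
proof -
  have "map w [0..<m + n] \<in> (\<lambda>(u, v). u @ v) ` (prefixes X m \<times> prefixes X n)"
    if "w \<in> X" for w
    unfolding map_upt_add prefixes_def using that shift_invariantD[OF assms that, of m] by auto
  then show ?thesis unfolding prefixes_def[of X "m + n"] by auto
qed

lemma card_prefixes_add:
  assumes "shift_invariant X" "X \<subseteq> full_shift q"
  shows "card (prefixes X (m + n)) \<le> card (prefixes X m) * card (prefixes X n)"
proof -
  have "card (prefixes X (m + n)) \<le> card ((\<lambda>(u, v). u @ v) ` (prefixes X m \<times> prefixes X n))"
    using prefixes_add[OF assms(1)] finite_prefixes[OF assms(2)]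
    by (intro card_mono) auto
  also have "\<dots> \<le> card (prefixes X m \<times> prefixes X n)"
    by (intro card_image_le) (simp add: finite_prefixes[OF assms(2)])
  finally show ?thesis by (simp add: card_cartesian_product)
qed

lemma card_prefixes_pos:
  assumes "X \<subseteq> full_shift q" "X \<noteq> {}"
  shows "0 < card (prefixes X n)"
  using finite_prefixes[OF assms(1)] assms(2) by (auto simp: card_gt_0_iff prefixes_def)

text \<open>Subadditive sequences: writing \<open>n = k * m + j\<close> with \<open>j < m\<close> bounds \<open>a n / n\<close> by
\<open>a m / m\<close> up to an error of order \<open>1 / n\<close>, so the quotients converge to their infimum. That
the limit is also a lower bound for every quotient is what later gives exponential lower bounds
without any error term.\<close>

lemma fekete:
  fixes a :: "nat \<Rightarrow> real"
  assumes sub: "\<And>m n. a (m + n) \<le> a m + a n" and nonneg: "\<And>n. 0 \<le> a n"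
  obtains L where "(\<lambda>n. a n / real n) \<longlonglongrightarrow> L" "\<And>n. real n * L \<le> a n" "0 \<le> L"
proof -
  define L where "L = (INF n\<in>{1..}. a n / real n)"
  have bdd: "bdd_below ((\<lambda>n. a n / real n) ` {1..})"
    by (intro bdd_belowI2[of _ 0]) (simp add: nonneg)
  have L_le: "L \<le> a n / real n" if "1 \<le> n" for n
    unfolding L_def using that bdd by (intro cINF_lower) auto
  have mult: "a (k * m) \<le> real k * a m" if "1 \<le> k" for k m
    using that
  proof (induction k rule: dec_induct)
    case (step k)
    have "a (Suc k * m) \<le> a m + a (k * m)" using sub[of m "k * m"] by simp
    then show ?case using step by (simp add: algebra_simps)
  qed simp
  have "(\<lambda>n. a n / real n) \<longlonglongrightarrow> L"
  proof (rule LIMSEQ_I)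
    fix e :: real assume e: "0 < e"
    have "(INF n\<in>{1..}. a n / real n) < L + e / 2" using e by (simp add: L_def)
    then obtain m where m: "1 \<le> m" "a m / real m < L + e / 2"
      using bdd by (subst (asm) cINF_less_iff) auto
    define M where "M = Max (a ` {..m})"
    have M: "a j \<le> M" if "j \<le> m" for j unfolding M_def using that by (intro Max_ge) auto
    have M0: "0 \<le> M" using M[of 0] nonneg[of 0] by simp
    \<comment> \<open>from \<open>N\<close> on the remainder \<open>a (n mod m)\<close>, at most \<open>M\<close>, contributes less than \<open>e / 2\<close>\<close>
    obtain N where N: "real N > 2 * M / e" using reals_Archimedean2 by blast
    show "\<exists>no. \<forall>n\<ge>no. norm (a n / real n - L) < e"
    proof (intro exI allI impI)
      fix n assume n: "n \<ge> max (Suc N) m"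
      have n1: "1 \<le> n" "0 < real n" using n by auto
      have k1: "1 \<le> n div m"
        using n m by (metis One_nat_def Suc_leI div_greater_zero_iff le0 less_le_trans
            max.bounded_iff not_less_zero not_one_le_zero bot_nat_0.not_eq_extremum)
      have "a n = a ((n div m) * m + n mod m)" by simp
      also have "\<dots> \<le> real (n div m) * a m + M"
        using sub[of "(n div m) * m" "n mod m"] mult[OF k1, of m] M[of "n mod m"] m
        by (smt (verit) mod_less_divisor less_imp_le less_le_trans zero_less_one)
      also have "real (n div m) * a m \<le> (real n / real m) * a m"
        using nonneg[of m] by (intro mult_right_mono) (auto simp: of_nat_div_le_of_nat)
      finally have "a n \<le> real n * (a m / real m) + M" by simp
      then have "a n / real n \<le> a m / real m + M / real n"
        using n1 by (simp add: field_simps)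
      moreover have "M / real n < e / 2"
      proof -
        have "2 * M / e < real n" using N n by linarith
        then show ?thesis using e n1 by (simp add: field_simps)
      qed
      ultimately have "a n / real n < L + e" using m by linarith
      then show "norm (a n / real n - L) < e" using L_le[OF n1(1)] by (simp add: abs_if)
    qed
  qed
  moreover have "real n * L \<le> a n" for n
    using L_le[of n] nonneg[of n] by (cases "n = 0") (auto simp: field_simps)
  moreover have "0 \<le> L"
    unfolding L_def by (intro cINF_greatest) (auto simp: nonneg)
  ultimately show thesis using that by blast
qed

text \<open>A prefix of length \<open>m + n\<close> of a point of a shift-invariant set splits into two shorter prefixes
of points of the same set, so the logarithms of the numbers of prefixes are subadditive. The limit
\<open>h\<close> is the topological entropy of the subshift.\<close>

lemma language_growth:
  assumes "shift_invariant X" "X \<subseteq> full_shift q" "X \<noteq> {}"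
  obtains h where "(\<lambda>n. 1 / real n * ln (real (card (prefixes X n)))) \<longlonglongrightarrow> h"
    and "\<And>n. exp (real n * h) \<le> real (card (prefixes X n))" and "0 \<le> h"
proof -
  have pos: "0 < real (card (prefixes X n))" for n
    using card_prefixes_pos[OF assms(2,3)] by simp
  have ge1: "1 \<le> real (card (prefixes X n))" for n
    using pos[of n] by simp
  have "ln (real (card (prefixes X (m + n))))
      \<le> ln (real (card (prefixes X m))) + ln (real (card (prefixes X n)))" for m n
  proof -
    have "real (card (prefixes X (m + n))) \<le> real (card (prefixes X m)) * real (card (prefixes X n))"
      using card_prefixes_add[OF assms(1,2), of m n] by (metis of_nat_le_iff of_nat_mult)
    then have "ln (real (card (prefixes X (m + n))))
        \<le> ln (real (card (prefixes X m)) * real (card (prefixes X n)))"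
      using pos by (intro ln_mono) auto
    then show ?thesis using pos by (subst (asm) ln_mult) auto
  qed
  moreover have "0 \<le> ln (real (card (prefixes X n)))" for n
    using ge1 by (intro ln_ge_zero)
  ultimately obtain h where h: "(\<lambda>n. ln (real (card (prefixes X n))) / real n) \<longlonglongrightarrow> h"
      "\<And>n. real n * h \<le> ln (real (card (prefixes X n)))" "0 \<le> h"
    using fekete[of "\<lambda>n. ln (real (card (prefixes X n)))"] by blast
  have "exp (real n * h) \<le> real (card (prefixes X n))" for n
    using h(2)[of n] pos[of n] by (metis exp_le_cancel_iff exp_ln)
  then show thesis using that h by simp
qed

section \<open>Covers by cylinders\<close>

text \<open>Furstenberg's counting argument. If finitely many cylinders cover a shift-invariant set, then every
long prefix begins with one of the covering words and continues with a shorter prefix, because the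
shifted point is again in the set. With \<open>a\<^sub>n\<close> the number of prefixes this reads
\<open>a\<^sub>n \<le> (\<Sum>u\<in>V. a\<^bsub>n - |u|\<^esub>)\<close>. If the total weight \<open>\<theta>\<close> of the cover were below 1,
the normalised numbers \<open>a\<^sub>n * r ^ n\<close> would shrink by the factor \<open>\<theta>\<close> over every stretch as long
as the longest covering word, and hence tend to 0, while they are at least 1.\<close>

lemma cover_weight_ge_1:
  fixes r :: real
  assumes X: "shift_invariant X" "X \<subseteq> full_shift q" and r: "0 < r"
    and growth: "\<And>n. 1 \<le> real (card (prefixes X n)) * r ^ n"
    and V: "finite V" "X \<subseteq> (\<Union>u\<in>V. cylinder u)"
  shows "1 \<le> (\<Sum>u\<in>V. r ^ length u)"
proof (rule ccontr)
  define \<theta> where "\<theta> = (\<Sum>u\<in>V. r ^ length u)"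
  assume "\<not> ?thesis"
  then have \<theta>: "\<theta> < 1" by (simp add: \<theta>_def)
  have \<theta>0: "0 \<le> \<theta>" unfolding \<theta>_def using r by (intro sum_nonneg) auto
  \<comment> \<open>the empty word alone has weight 1\<close>
  have nonempty: "0 < length u" if "u \<in> V" for u
  proof (rule ccontr)
    assume "\<not> 0 < length u"
    then have "r ^ length u = 1" by simp
    moreover have "r ^ length u \<le> \<theta>"
      unfolding \<theta>_def using that V(1) r by (intro member_le_sum) auto
    ultimately show False using \<theta> by simp
  qed
  define b where "b n = real (card (prefixes X n)) * r ^ n" for n
  define l where "l = Max (insert 0 (length ` V))"
  have l: "length u \<le> l" if "u \<in> V" for u unfolding l_def using that V(1) by (intro Max_ge) auto
  have rec: "b n \<le> (\<Sum>u\<in>V. r ^ length u * b (n - length u))" if "l \<le> n" for n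
  proof -
    have "prefixes X n \<subseteq> (\<Union>u\<in>V. (\<lambda>v. u @ v) ` prefixes X (n - length u))"
    proof
      fix x assume "x \<in> prefixes X n"
      then obtain w where w: "w \<in> X" "x = map w [0..<n]" unfolding prefixes_def by blast
      then obtain u where u: "u \<in> V" "map w [0..<length u] = u"
        using V(2) unfolding cylinder_def by blast
      have "x = map w [0..<length u + (n - length u)]"
        using w l[OF u(1)] that by simp
      then have "x = u @ map (\<lambda>j. w (j + length u)) [0..<n - length u]"
        unfolding map_upt_add u(2) .
      moreover have "map (\<lambda>j. w (j + length u)) [0..<n - length u] \<in> prefixes X (n - length u)"
        unfolding prefixes_def using shift_invariantD[OF X(1) w(1)] by blast
      ultimately show "x \<in> (\<Union>u\<in>V. (\<lambda>v. u @ v) ` prefixes X (n - length u))"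
        using u(1) by blast
    qed
    then have "card (prefixes X n) \<le> card (\<Union>u\<in>V. (\<lambda>v. u @ v) ` prefixes X (n - length u))"
      using V(1) finite_prefixes[OF X(2)] by (intro card_mono) auto
    also have "\<dots> \<le> (\<Sum>u\<in>V. card ((\<lambda>v. u @ v) ` prefixes X (n - length u)))"
      using V(1) by (rule card_UN_le)
    also have "\<dots> \<le> (\<Sum>u\<in>V. card (prefixes X (n - length u)))"
      using finite_prefixes[OF X(2)] by (intro sum_mono card_image_le)
    finally have "real (card (prefixes X n)) \<le> (\<Sum>u\<in>V. real (card (prefixes X (n - length u))))"
      by (metis of_nat_le_iff of_nat_sum)
    then have "b n \<le> (\<Sum>u\<in>V. real (card (prefixes X (n - length u)))) * r ^ n"
      unfolding b_def using r by (intro mult_right_mono) auto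
    also have "\<dots> = (\<Sum>u\<in>V. r ^ length u * b (n - length u))"
      unfolding b_def sum_distrib_right
    proof (intro sum.cong refl)
      fix u assume "u \<in> V"
      then have "r ^ n = r ^ length u * r ^ (n - length u)"
        using l[of u] that by (simp flip: power_add)
      then show "real (card (prefixes X (n - length u))) * r ^ n
          = r ^ length u * (real (card (prefixes X (n - length u))) * r ^ (n - length u))"
        by simp
    qed
    finally show ?thesis .
  qed
  \<comment> \<open>a bound valid from \<open>N\<close> on improves by the factor \<open>\<theta>\<close> from \<open>N + l\<close> on\<close>
  have improve: "b n \<le> \<theta> * M"
    if M: "\<And>k. N \<le> k \<Longrightarrow> k < n \<Longrightarrow> b k \<le> M" and n: "N + l \<le> n" for N M n
  proof -
    have "b n \<le> (\<Sum>u\<in>V. r ^ length u * b (n - length u))" using rec n by simp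
    also have "\<dots> \<le> (\<Sum>u\<in>V. r ^ length u * M)"
    proof (intro sum_mono mult_left_mono)
      fix u assume "u \<in> V"
      then show "b (n - length u) \<le> M" using l[of u] nonempty[of u] n by (intro M) linarith+
    qed (use r in auto)
    also have "\<dots> = \<theta> * M" by (simp add: \<theta>_def sum_distrib_right)
    finally show ?thesis .
  qed
  define M where "M = Max (b ` {..l})"
  have M: "b k \<le> M" if "k \<le> l" for k unfolding M_def using that by (intro Max_ge) auto
  have M0: "0 < M" using M[of 0] growth[of 0] by (simp add: b_def)
  have bound: "b n \<le> M" for n
  proof (induction n rule: less_induct)
    case (less n)
    show ?case
    proof (cases "n \<le> l")
      case False
      then have "b n \<le> \<theta> * M" using less by (intro improve[where N = 0]) auto
      also have "\<dots> \<le> M" using \<theta> \<theta>0 M0 by (simp add: mult_le_cancel_right1)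
      finally show ?thesis .
    qed (rule M)
  qed
  have "\<exists>N. \<forall>n\<ge>N. b n \<le> \<theta> ^ k * M" for k
  proof (induction k)
    case 0
    then show ?case using bound by simp
  next
    case (Suc k)
    then obtain N where "\<forall>n\<ge>N. b n \<le> \<theta> ^ k * M" by blast
    then have "\<forall>n\<ge>N + l. b n \<le> \<theta> * (\<theta> ^ k * M)" using improve by blast
    then show ?case by (auto simp: mult.assoc)
  qed
  then have "1 \<le> \<theta> ^ k * M" for k
    using growth unfolding b_def by (meson order_refl order_trans)
  moreover have "(\<lambda>k. \<theta> ^ k * M) \<longlonglongrightarrow> 0"
    using \<theta> \<theta>0 by (intro tendsto_mult_left_zero LIMSEQ_power_zero) auto
  ultimately have "1 \<le> (0::real)" by (intro LIMSEQ_le_const) auto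
  then show False by simp
qed

lemma open_cylinder: "open (cylinder (u :: nat list))"
proof -
  have "cylinder u = (\<Inter>i\<in>{..<length u}. (\<lambda>w. w i) -` {u ! i})"
    by (auto simp: mem_cylinder)
  also have "open \<dots>"
    by (intro open_INT ballI open_vimage continuous_on_product_coordinates open_discrete) auto
  finally show ?thesis .
qed

lemma compact_full_shift: "compact (full_shift q)"
proof -
  have "full_shift q = PiE UNIV (\<lambda>_. alphabet q)"
    unfolding full_shift_def by auto
  moreover have "compactin euclidean (PiE UNIV (\<lambda>_::nat. alphabet q))"
    unfolding euclidean_product_topology[symmetric] compactin_PiE
    by (auto simp: alphabet_def finite_imp_compact)
  ultimately show ?thesis by simp
qed

text \<open>For \<open>r = q powr -s\<close> a cylinder of length \<open>n\<close> has weight \<open>(q powr -n) powr s\<close>, so these sets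
are negligible for the \<open>s\<close>-dimensional measure. Each single cover is required to be finite because
the covering families of \<open>countable_cover_weight\<close> below are sequences of finite sets of words.\<close>

definition small_weight :: "real \<Rightarrow> (nat \<Rightarrow> nat) set \<Rightarrow> bool" where
  "small_weight r Y \<longleftrightarrow>
     (\<forall>\<epsilon>>0. \<exists>V. finite V \<and> Y \<subseteq> (\<Union>u\<in>V. cylinder u) \<and> (\<Sum>u\<in>V. r ^ length u) < \<epsilon>)"

lemma sum_UN_le:
  fixes g :: "'a \<Rightarrow> real" and N :: nat
  assumes "\<And>i. finite (A i)" "\<And>x. 0 \<le> g x"
  shows "sum g (\<Union>i<N. A i) \<le> (\<Sum>i<N. sum g (A i))"
proof (induction N)
  case (Suc N)
  have "sum g (\<Union>i<Suc N. A i) = sum g ((\<Union>i<N. A i) \<union> A N)"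
    by (simp add: lessThan_Suc Un_commute)
  also have "\<dots> \<le> sum g (\<Union>i<N. A i) + sum g (A N)"
    using assms by (simp add: sum_Un sum_nonneg)
  finally show ?case using Suc by simp
qed simp

text \<open>Countable form of \<open>cover_weight_ge_1\<close>. Countably many negligible sets \<open>Y i\<close> may be added to the
cover for a total price smaller than \<open>1 - \<theta>\<close>; since cylinders are open, compactness leaves only
finitely many of them, and then a partial sum of the weights of the \<open>V i\<close> must exceed \<open>\<theta>\<close>.\<close>

lemma countable_cover_weight:
  fixes r :: real
  assumes X: "shift_invariant X" "X \<subseteq> full_shift q" "compact X" and r: "0 < r"
    and growth: "\<And>n. 1 \<le> real (card (prefixes X n)) * r ^ n"
    and V: "\<And>i. finite (V i)" and small: "\<And>i. small_weight r (Y i)"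
    and cover: "X \<subseteq> (\<Union>i::nat. (\<Union>u\<in>V i. cylinder u) \<union> Y i)" and \<theta>: "\<theta> < 1"
  obtains N where "\<theta> < (\<Sum>i<N. \<Sum>u\<in>V i. r ^ length u)"
proof -
  \<comment> \<open>the errors add up to less than the slack \<open>1 - \<theta>\<close>\<close>
  define \<epsilon> where "\<epsilon> i = (1 - \<theta>) / 2 * (1 / 2) ^ i" for i :: nat
  have \<epsilon>0: "0 < \<epsilon> i" for i using \<theta> by (simp add: \<epsilon>_def)
  have \<epsilon>: "(\<Sum>i<N. \<epsilon> i) < 1 - \<theta>" for N
  proof -
    have "(\<Sum>i<N. \<epsilon> i) = (1 - \<theta>) * (1 - (1 / 2) ^ N)"
      unfolding \<epsilon>_def sum_distrib_left[symmetric] by (simp add: sum_gp_strict)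
    also have "\<dots> < (1 - \<theta>) * 1" using \<theta> by (intro mult_strict_left_mono) auto
    finally show ?thesis by simp
  qed
  have "\<forall>i. \<exists>U. finite U \<and> Y i \<subseteq> (\<Union>u\<in>U. cylinder u) \<and> (\<Sum>u\<in>U. r ^ length u) < \<epsilon> i"
    using small \<epsilon>0 unfolding small_weight_def by blast
  then obtain U where U: "\<And>i. finite (U i)" "\<And>i. Y i \<subseteq> (\<Union>u\<in>U i. cylinder u)"
      "\<And>i. (\<Sum>u\<in>U i. r ^ length u) < \<epsilon> i"
    by metis
  have "X \<subseteq> (\<Union>i. \<Union>u\<in>V i \<union> U i. cylinder u)"
  proof
    fix w assume "w \<in> X"
    then obtain i where "w \<in> (\<Union>u\<in>V i. cylinder u) \<union> Y i" using cover by blast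
    then have "w \<in> (\<Union>u\<in>V i \<union> U i. cylinder u)" using U(2)[of i] by blast
    then show "w \<in> (\<Union>i. \<Union>u\<in>V i \<union> U i. cylinder u)" by blast
  qed
  then obtain I where I: "finite I" "X \<subseteq> (\<Union>i\<in>I. \<Union>u\<in>V i \<union> U i. cylinder u)"
    by (rule compactE_image[OF X(3), rotated]) (blast, intro open_UN ballI open_cylinder)
  obtain N where N: "I \<subseteq> {..<N}" using I(1) finite_nat_iff_bounded by blast
  define T where "T = (\<Union>i<N. V i \<union> U i)"
  have "finite T" unfolding T_def using V U(1) by auto
  moreover have "X \<subseteq> (\<Union>u\<in>T. cylinder u)" 
  proof
    fix w assume "w \<in> X"
    then obtain i u where "i \<in> I" "u \<in> V i \<union> U i" "w \<in> cylinder u" using I(2) by blast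
    then show "w \<in> (\<Union>u\<in>T. cylinder u)" unfolding T_def using N by blast
  qed
  ultimately have "1 \<le> (\<Sum>u\<in>T. r ^ length u)"
    by (intro cover_weight_ge_1[OF X(1,2) r growth])
  also have "\<dots> \<le> (\<Sum>i<N. \<Sum>u\<in>V i \<union> U i. r ^ length u)"
    unfolding T_def using V U(1) r by (intro sum_UN_le) auto
  also have "\<dots> \<le> (\<Sum>i<N. (\<Sum>u\<in>V i. r ^ length u) + (\<Sum>u\<in>U i. r ^ length u))"
    using V U(1) r by (intro sum_mono) (simp add: sum_Un sum_nonneg)
  also have "\<dots> \<le> (\<Sum>i<N. \<Sum>u\<in>V i. r ^ length u) + (\<Sum>i<N. \<epsilon> i)"
    unfolding sum.distrib using U(3) by (intro add_left_mono sum_mono) (simp add: less_imp_le)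
  finally have "\<theta> < (\<Sum>i<N. \<Sum>u\<in>V i. r ^ length u)" using \<epsilon>[of N] by simp
  then show thesis by (rule that)
qed

lemma small_weight_singleton:
  assumes "0 < r" "r < 1"
  shows "small_weight r {w}"
  unfolding small_weight_def
proof (intro allI impI)
  fix \<epsilon> :: real assume \<epsilon>: "0 < \<epsilon>"
  obtain n where n: "r ^ n < \<epsilon>" using real_arch_pow_inv[OF \<epsilon> assms(2)] by blast
  show "\<exists>V. finite V \<and> {w} \<subseteq> (\<Union>u\<in>V. cylinder u) \<and> (\<Sum>u\<in>V. r ^ length u) < \<epsilon>"
    by (rule exI[of _ "{map w [0..<n]}"]) (simp add: cylinder_def n)
qed

text \<open>A word all of whose factors of length \<open>n\<close> lie in \<open>F\<close> is a concatenation of blocks from \<open>F\<close>, so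
at most \<open>card F ^ k\<close> cylinders of length \<open>k * n\<close> are needed; their total weight is a power of a
number below 1.\<close>

lemma small_weight_few_factors:
  assumes r: "0 < r" and F: "finite F" "real (card F) * r ^ n < 1"
  shows "small_weight r {w. factors w n \<subseteq> F}"
  unfolding small_weight_def
proof (intro allI impI)
  fix \<epsilon> :: real assume \<epsilon>: "0 < \<epsilon>"
  obtain k where k: "(real (card F) * r ^ n) ^ k < \<epsilon>"
    using real_arch_pow_inv[OF \<epsilon> F(2)] by blast
  define Y where "Y = {w. factors w n \<subseteq> F}"
  have Y1: "prefixes Y n \<subseteq> F"
  proof -
    have "map w [0..<n] \<in> F" if "w \<in> Y" for w
      using that unfolding Y_def factors_def by (auto intro: exI[of _ 0])
    then show ?thesis unfolding prefixes_def by auto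
  qed
  have inv: "shift_invariant Y"
    unfolding shift_invariant_def Y_def using factors_shift_subset by blast
  have card: "finite (prefixes Y (k * n)) \<and> card (prefixes Y (k * n)) \<le> card F ^ k" for k
  proof (induction k)
    case 0
    have "prefixes Y 0 \<subseteq> {[]}" by (auto simp: prefixes_def)
    then show ?case
      using card_mono[of "{[]}" "prefixes Y 0"] by (auto intro: finite_subset)
  next
    case (Suc k)
    let ?P = "F \<times> prefixes Y (k * n)"
    have sub: "prefixes Y (Suc k * n) \<subseteq> (\<lambda>(u, v). u @ v) ` ?P"
      using prefixes_add[OF inv, of n "k * n"] Y1 by fastforce
    have "card (prefixes Y (Suc k * n)) \<le> card ((\<lambda>(u, v). u @ v) ` ?P)"
      using Suc F(1) by (intro card_mono sub) auto
    also have "\<dots> \<le> card ?P" using Suc F(1) by (intro card_image_le) auto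
    also have "\<dots> \<le> card F ^ Suc k" using Suc by (simp add: card_cartesian_product)
    finally show ?case using Suc F(1) finite_subset[OF sub] by auto
  qed
  have "(\<Sum>u\<in>prefixes Y (k * n). r ^ length u) = (\<Sum>u\<in>prefixes Y (k * n). r ^ (k * n))"
    by (intro sum.cong) (auto simp: prefixes_def)
  also have "\<dots> \<le> real (card F ^ k) * r ^ (k * n)"
    using card[of k] r by (simp del: of_nat_power add: mult_right_mono)
  also have "\<dots> = (real (card F) * r ^ n) ^ k"
    by (simp add: power_mult_distrib power_mult[symmetric] mult.commute)
  finally have "(\<Sum>u\<in>prefixes Y (k * n). r ^ length u) < \<epsilon>" using k by simp
  moreover have "Y \<subseteq> (\<Union>u\<in>prefixes Y (k * n). cylinder u)"
    by (auto simp: prefixes_def cylinder_def)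
  ultimately show "\<exists>V. finite V \<and> {w. factors w n \<subseteq> F} \<subseteq> (\<Union>u\<in>V. cylinder u)
      \<and> (\<Sum>u\<in>V. r ^ length u) < \<epsilon>"
    using card[of k] unfolding Y_def by blast
qed

text \<open>This replaces the variational principle: a compact subshift contains one point whose factors already
grow as fast as the whole language. A point for which this fails at length \<open>n\<close> has a set \<open>F\<close> of
factors of length \<open>n\<close> with \<open>card F * r ^ n < 1\<close>. There are only countably many pairs \<open>(n, F)\<close>,
and each of them accounts for a negligible set of points by \<open>small_weight_few_factors\<close>. If every
point failed, these sets would cover the subshift, against \<open>countable_cover_weight\<close>.\<close>

lemma ex_maximal_complexity:
  fixes r :: real
  assumes X: "shift_invariant X" "X \<subseteq> full_shift q" "compact X" and r: "0 < r"
    and growth: "\<And>n. 1 \<le> real (card (prefixes X n)) * r ^ n"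
  obtains w where "w \<in> X" "\<And>n. 1 \<le> real (complexity w n) * r ^ n"
proof (rule ccontr)
  assume "\<not> thesis"
  then have few: "\<forall>w\<in>X. \<exists>n. real (complexity w n) * r ^ n < 1"
    by (meson not_le that)
  define D where "D = {(n :: nat, F :: nat list set). finite F \<and> real (card F) * r ^ n < 1}"
  have "D \<subseteq> UNIV \<times> {F. finite F}" unfolding D_def by auto
  then have "countable D"
    by (rule countable_subset) (intro countable_SIGMA countable_Collect_finite countableI_type)
  moreover have "(0, {}) \<in> D" by (simp add: D_def)
  ultimately obtain d :: "nat \<Rightarrow> nat \<times> nat list set" where d: "range d = D"
    using range_from_nat_into[of D] by blast
  define Y where "Y i = {w. factors w (fst (d i)) \<subseteq> snd (d i)}" for i :: nat
  have "small_weight r (Y i)" for i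
  proof -
    have "d i \<in> D" using d by blast
    then show ?thesis unfolding Y_def by (intro small_weight_few_factors r) (auto simp: D_def)
  qed
  moreover have "X \<subseteq> (\<Union>i. (\<Union>u\<in>{}. cylinder u) \<union> Y i)"
  proof
    fix w assume w: "w \<in> X"
    obtain n where "real (complexity w n) * r ^ n < 1" using few w by blast
    then have "(n, factors w n) \<in> D"
      using finite_factors w X(2) unfolding D_def complexity_def by blast
    then obtain i where "d i = (n, factors w n)" using d by (metis (no_types, lifting) imageE)
    then have "w \<in> Y i" by (simp add: Y_def)
    then show "w \<in> (\<Union>i. (\<Union>u\<in>{}. cylinder u) \<union> Y i)" by blast
  qed
  ultimately obtain N :: nat where "(0::real) < (\<Sum>i<N. \<Sum>u\<in>({}::nat list set). r ^ length u)"
    by (rule countable_cover_weight[OF X r growth, where V = "\<lambda>_. {}" and Y = Y and \<theta> = 0, rotated])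
      auto
  then show False by simp
qed

section \<open>Base-q values of words\<close>

definition val :: "nat \<Rightarrow> (nat \<Rightarrow> nat) \<Rightarrow> real" where
  "val q w = (\<Sum>i. real (w i) / real q ^ (i + 1))"

primrec prefix_num :: "nat \<Rightarrow> (nat \<Rightarrow> nat) \<Rightarrow> nat \<Rightarrow> nat" where
  "prefix_num q w 0 = 0"
| "prefix_num q w (Suc n) = q * prefix_num q w n + w n"

lemma full_shift_less: "w \<in> full_shift q \<Longrightarrow> w i < q"
  unfolding full_shift_def alphabet_def by (auto simp: image_subset_iff)

lemma top_digits_sums:
  assumes "q \<ge> 2"
  shows "(\<lambda>i. (real q - 1) / real q ^ (i + 1)) sums 1"
proof -
  have "(\<lambda>i. (real q - 1) / real q * (1 / real q) ^ i) sums ((real q - 1) / real q * (1 / (1 - 1 / real q)))"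
    using assms by (intro sums_mult geometric_sums) auto
  moreover have "(real q - 1) / real q * (1 / (1 - 1 / real q)) = 1"
    using assms by (simp add: field_simps)
  moreover have "(real q - 1) / real q * (1 / real q) ^ i = (real q - 1) / real q ^ (i + 1)" for i
    by (simp add: power_one_over field_simps)
  ultimately show ?thesis by (simp only:)
qed

lemma digit_term_bound:
  assumes "w \<in> full_shift q"
  shows "norm (real (w i) / real q ^ (i + 1)) \<le> (real q - 1) / real q ^ (i + 1)"
proof -
  have "real (w i) \<le> real q - 1" using full_shift_less[OF assms, of i] by linarith
  then show ?thesis by (simp add: divide_right_mono)
qed

lemma val_summable:
  assumes "q \<ge> 2" "w \<in> full_shift q"
  shows "summable (\<lambda>i. real (w i) / real q ^ (i + 1))"
  using digit_term_bound[OF assms(2)] sums_summable[OF top_digits_sums[OF assms(1)]]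
  by (rule summable_comparison_test'[where N = 0, rotated])

lemma val_nonneg:
  assumes "q \<ge> 2" "w \<in> full_shift q"
  shows "0 \<le> val q w"
  unfolding val_def using val_summable[OF assms] by (intro suminf_nonneg) auto

lemma val_le_1:
  assumes "q \<ge> 2" "w \<in> full_shift q"
  shows "val q w \<le> 1"
proof -
  have "val q w \<le> (\<Sum>i. (real q - 1) / real q ^ (i + 1))"
    unfolding val_def
    using digit_term_bound[OF assms(2)] val_summable[OF assms] top_digits_sums[OF assms(1)]
    by (intro suminf_le) (auto simp: sums_iff)
  then show ?thesis using top_digits_sums[OF assms(1)] by (simp add: sums_iff)
qed

lemma represents_iff:
  assumes "q \<ge> 2"
  shows "represents q w x \<longleftrightarrow> w \<in> full_shift q \<and> val q w = x"
  unfolding represents_def val_def using val_summable[OF assms, of w]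
  by (auto simp: full_shift_def sums_iff)

lemma val_Suc:
  assumes "q \<ge> 2" "w \<in> full_shift q"
  shows "real q * val q w = real (w 0) + val q (\<lambda>j. w (Suc j))"
proof -
  have "val q w = (\<Sum>i. real (w (Suc i)) / real q ^ (Suc i + 1)) + real (w 0) / real q"
    unfolding val_def using suminf_split_head[OF val_summable[OF assms]] by simp
  also have "(\<Sum>i. real (w (Suc i)) / real q ^ (Suc i + 1))
      = (\<Sum>i. (1 / real q) * (real (w (Suc i)) / real q ^ (i + 1)))"
    by (intro suminf_cong) simp
  also have "\<dots> = (1 / real q) * val q (\<lambda>j. w (Suc j))"
    unfolding val_def using val_summable[OF assms(1), of "\<lambda>j. w (Suc j)"] shift_in_full_shift[OF assms(2), of 1]
    by (intro suminf_mult) simp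
  finally show ?thesis using assms(1) by (simp add: field_simps)
qed

lemma val_prefix:
  assumes "q \<ge> 2" "w \<in> full_shift q"
  shows "real q ^ n * val q w = real (prefix_num q w n) + val q (\<lambda>j. w (j + n))"
proof (induction n)
  case (Suc n)
  have "real q ^ Suc n * val q w = real q * (real (prefix_num q w n) + val q (\<lambda>j. w (j + n)))"
    using Suc by simp
  also have "\<dots> = real q * real (prefix_num q w n) + (real (w n) + val q (\<lambda>j. w (Suc j + n)))"
    using val_Suc[OF assms(1) shift_in_full_shift[OF assms(2)], of n] by (simp add: distrib_left)
  finally show ?case by simp
qed simp

lemma val_bounds:
  assumes "q \<ge> 2" "w \<in> full_shift q"
  shows "real (prefix_num q w n) \<le> real q ^ n * val q w"
    and "real q ^ n * val q w \<le> real (prefix_num q w n) + 1"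
  using val_prefix[OF assms, of n] val_nonneg[OF assms(1) shift_in_full_shift[OF assms(2)], of n]
    val_le_1[OF assms(1) shift_in_full_shift[OF assms(2)], of n] by auto

lemma prefix_num_cong: "map w [0..<n] = map v [0..<n] \<Longrightarrow> prefix_num q w n = prefix_num q v n"
  by (induction n) auto

lemma prefix_num_inj:
  assumes "w \<in> full_shift q" "v \<in> full_shift q" "prefix_num q w n = prefix_num q v n"
  shows "map w [0..<n] = map v [0..<n]"
  using assms(3)
proof (induction n)
  case (Suc n)
  have lt: "w n < q" "v n < q" using assms full_shift_less by auto
  have eq: "q * prefix_num q w n + w n = q * prefix_num q v n + v n" using Suc.prems by simp
  have "w n = v n" using arg_cong[OF eq, of "\<lambda>x. x mod q"] lt by simp
  moreover have "prefix_num q w n = prefix_num q v n"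
    using eq lt \<open>w n = v n\<close> by simp
  ultimately show ?case using Suc.IH by simp
qed simp

lemma val_continuous_on:
  assumes "q \<ge> 2"
  shows "continuous_on (full_shift q) (val q)"
proof -
  have disc: "continuous_on UNIV (real :: nat \<Rightarrow> real)"
    by (simp add: continuous_on_open_vimage open_discrete)
  have coord: "continuous_on (full_shift q) (\<lambda>w. real (w i))" for i
    by (rule continuous_on_compose2[OF disc])
      (auto intro: continuous_on_subset[OF continuous_on_product_coordinates])
  have "uniform_limit (full_shift q) (\<lambda>n w. \<Sum>i<n. real (w i) / real q ^ (i + 1))
      (\<lambda>w. \<Sum>i. real (w i) / real q ^ (i + 1)) sequentially"
    using digit_term_bound sums_summable[OF top_digits_sums[OF assms]]
    by (intro Weierstrass_m_test) auto
  moreover have "continuous_on (full_shift q) (\<lambda>w. \<Sum>i<n. real (w i) / real q ^ (i + 1))" for n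
    using assms by (intro continuous_intros coord) auto
  ultimately show ?thesis
    unfolding val_def by (intro uniform_limit_theorem) auto
qed

section \<open>The digit word\<close>

lemma val_eq_0:
  assumes "q \<ge> 2" "w \<in> full_shift q" "val q w = 0"
  shows "w i = 0"
proof -
  have head: "v 0 = 0 \<and> val q (\<lambda>j. v (Suc j)) = 0" if "v \<in> full_shift q" "val q v = 0" for v
    using val_Suc[OF assms(1) that(1)] that(2)
      val_nonneg[OF assms(1) shift_in_full_shift[OF that(1), of 1]] by simp
  have "val q (\<lambda>j. w (j + i)) = 0"
  proof (induction i)
    case (Suc i)
    then show ?case using head[OF shift_in_full_shift[OF assms(2)], of i] by simp
  qed (use assms in simp)
  then show ?thesis using head[OF shift_in_full_shift[OF assms(2)], of i] by simp
qed

lemma val_eq_1: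
  assumes "q \<ge> 2" "w \<in> full_shift q" "val q w = 1"
  shows "w i = q - 1"
proof -
  have head: "v 0 = q - 1 \<and> val q (\<lambda>j. v (Suc j)) = 1" if "v \<in> full_shift q" "val q v = 1" for v
  proof -
    have "real q = real (v 0) + val q (\<lambda>j. v (Suc j))" using val_Suc[OF assms(1) that(1)] that(2) by simp
    moreover have "val q (\<lambda>j. v (Suc j)) \<le> 1"
      using val_le_1[OF assms(1) shift_in_full_shift[OF that(1), of 1]] by simp
    moreover have "v 0 < q" using full_shift_less[OF that(1)] .
    then have "real (v 0) \<le> real q - 1" by linarith
    ultimately have "real (v 0) = real q - 1" "val q (\<lambda>j. v (Suc j)) = 1" by linarith+
    then show ?thesis using assms(1) by linarith
  qed
  have "val q (\<lambda>j. w (j + i)) = 1"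
  proof (induction i)
    case (Suc i)
    then show ?case using head[OF shift_in_full_shift[OF assms(2)], of i] by simp
  qed (use assms in simp)
  then show ?thesis using head[OF shift_in_full_shift[OF assms(2)], of i] by simp
qed

definition zero_tail :: "(nat \<Rightarrow> nat) \<Rightarrow> bool" where
  "zero_tail w \<longleftrightarrow> (\<exists>N. \<forall>i\<ge>N. w i = 0)"

definition top_tail :: "nat \<Rightarrow> (nat \<Rightarrow> nat) \<Rightarrow> bool" where
  "top_tail q w \<longleftrightarrow> (\<exists>N. \<forall>i\<ge>N. w i = q - 1)"

lemma not_zero_and_top_tail:
  assumes "q \<ge> 2"
  shows "\<not> (zero_tail w \<and> top_tail q w)"
proof
  assume "zero_tail w \<and> top_tail q w"
  then obtain M N where "\<forall>i\<ge>M. w i = 0" and "\<forall>i\<ge>N. w i = q - 1"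
    unfolding zero_tail_def top_tail_def by blast
  then have "w (max M N) = 0" and "w (max M N) = q - 1" by (meson max.cobounded1 max.cobounded2)+
  then show False using assms by linarith
qed

text \<open>At the first position where the expansions differ the digits differ by exactly 1, since the tails
have values in \<open>[0, 1]\<close>; so the tail after the larger digit has value 0 and the other one has
value 1.\<close>

lemma two_expansions:
  assumes q: "q \<ge> 2" and w: "w \<in> full_shift q" and v: "v \<in> full_shift q"
    and eq: "val q w = val q v" and "w \<noteq> v"
  shows "zero_tail w \<and> top_tail q v \<or> zero_tail v \<and> top_tail q w"
proof -
  define N where "N = (LEAST i. w i \<noteq> v i)"
  have "\<exists>i. w i \<noteq> v i" using \<open>w \<noteq> v\<close> by auto
  then have N: "w N \<noteq> v N" unfolding N_def by (rule LeastI_ex)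
  have "w i = v i" if "i < N" for i
    using that not_less_Least[of i "\<lambda>i. w i \<noteq> v i"] unfolding N_def by blast
  then have "map w [0..<N] = map v [0..<N]" by simp
  then have num: "prefix_num q w N = prefix_num q v N" by (rule prefix_num_cong)
  have *: "zero_tail w \<and> top_tail q v"
    if w: "w \<in> full_shift q" and v: "v \<in> full_shift q" and eq: "val q w = val q v"
      and num: "prefix_num q w N = prefix_num q v N" and less: "v N < w N" for w v
  proof -
    let ?w = "val q (\<lambda>j. w (j + Suc N))" and ?v = "val q (\<lambda>j. v (j + Suc N))"
    have "real (w N) + ?w = real (v N) + ?v"
      using val_prefix[OF q w, of "Suc N"] val_prefix[OF q v, of "Suc N"] num eq by simp
    moreover have "0 \<le> ?w" "?v \<le> 1"
      by (rule val_nonneg[OF q shift_in_full_shift[OF w]]) (rule val_le_1[OF q shift_in_full_shift[OF v]])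
    moreover have "real (v N) + 1 \<le> real (w N)" using less by linarith
    ultimately have "?w = 0" "?v = 1" by linarith+
    then have "w (j + Suc N) = 0 \<and> v (j + Suc N) = q - 1" for j
      using val_eq_0[OF q shift_in_full_shift[OF w, of "Suc N"], of j]
        val_eq_1[OF q shift_in_full_shift[OF v, of "Suc N"], of j] by blast
    then have "\<forall>i\<ge>Suc N. w i = 0" "\<forall>i\<ge>Suc N. v i = q - 1"
      by (metis le_add_diff_inverse2)+
    then show ?thesis unfolding zero_tail_def top_tail_def by blast
  qed
  from N consider "v N < w N" | "w N < v N" by linarith
  then show ?thesis using *[OF w v eq num] *[OF v w eq[symmetric] num[symmetric]] by cases auto
qed

lemma psi_bounds: "0 \<le> psi q x" "psi q x < 1"
  unfolding psi_def by linarith+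

text \<open>The digits are read off along the orbit of \<open>x\<close> under \<open>psi q\<close>; the point 1 is separate, because
\<open>psi q\<close> sends it to 0.\<close>

lemma ex_expansion:
  assumes q: "q \<ge> 2" and x: "x \<in> {0..1}"
  obtains w where "w \<in> full_shift q" "val q w = x"
proof (cases "x = 1")
  case True
  have "(\<lambda>_. q - 1) \<in> full_shift q" using q by (auto simp: full_shift_def alphabet_def)
  moreover have "val q (\<lambda>_. q - 1) = 1"
    unfolding val_def using top_digits_sums[OF q] q by (simp add: sums_iff of_nat_diff)
  ultimately show thesis using that True by blast
next
  case False
  define y where "y n = (psi q ^^ n) x" for n
  define w where "w n = nat \<lfloor>real q * y n\<rfloor>" for n
  have y: "0 \<le> y n" "y n < 1" for n
    using x False psi_bounds by (cases n; auto simp: y_def)+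
  have real_w: "real (w n) = real q * y n - y (Suc n)" for n
    using y(1)[of n] by (simp add: w_def y_def psi_def)
  have "real (w n) < real q" for n
  proof -
    have "real q * y n < real q * 1" using y[of n] q by (intro mult_strict_left_mono) auto
    then show ?thesis using real_w[of n] y(1)[of "Suc n"] by simp
  qed
  then have w: "w \<in> full_shift q" unfolding full_shift_def alphabet_def by auto
  have part: "(\<Sum>i<n. real (w i) / real q ^ (i + 1)) = x - y n * (1 / real q) ^ n" for n
  proof (induction n)
    case (Suc n)
    have "(\<Sum>i<Suc n. real (w i) / real q ^ (i + 1))
        = x - y n * (1 / real q) ^ n + real (w n) / real q ^ (n + 1)"
      using Suc by simp
    also have "\<dots> = x - y (Suc n) * (1 / real q) ^ Suc n"
      using q by (simp add: real_w field_simps power_one_over)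
    finally show ?case .
  qed (simp add: y_def)
  have "(\<lambda>n. y n * (1 / real q) ^ n) \<longlonglongrightarrow> 0"
  proof (rule tendsto_sandwich)
    show "\<forall>\<^sub>F n in sequentially. 0 \<le> y n * (1 / real q) ^ n" using y by simp
    show "\<forall>\<^sub>F n in sequentially. y n * (1 / real q) ^ n \<le> (1 / real q) ^ n"
      using y by (intro always_eventually allI mult_left_le_one_le) (auto intro: less_imp_le)
    show "(\<lambda>n. (1 / real q) ^ n) \<longlonglongrightarrow> 0"
      using q by (intro LIMSEQ_power_zero) auto
  qed simp
  then have "(\<lambda>n. x - y n * (1 / real q) ^ n) \<longlonglongrightarrow> x - 0" by (intro tendsto_intros)
  then have "(\<lambda>i. real (w i) / real q ^ (i + 1)) sums x" unfolding sums_def part by simp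
  then have "val q w = x" unfolding val_def by (simp add: sums_iff)
  then show thesis using that w by blast
qed

lemma digit_word_eqI:
  assumes q: "q \<ge> 2" and w: "w \<in> full_shift q" "\<And>v. v \<in> full_shift q \<Longrightarrow> val q v = val q w \<Longrightarrow> v \<noteq> w \<Longrightarrow> zero_tail w"
  shows "digit_word q (val q w) = w"
  unfolding digit_word_def represents_iff[OF q]
proof (rule the_equality)
  show "(w \<in> full_shift q \<and> val q w = val q w) \<and>
    ((\<exists>v. (v \<in> full_shift q \<and> val q v = val q w) \<and> v \<noteq> w) \<longrightarrow> (\<exists>N. \<forall>i\<ge>N. w i = 0))"
    using w unfolding zero_tail_def by blast
next
  fix u
  assume u: "(u \<in> full_shift q \<and> val q u = val q w) \<and>
    ((\<exists>v. (v \<in> full_shift q \<and> val q v = val q w) \<and> v \<noteq> u) \<longrightarrow> (\<exists>N. \<forall>i\<ge>N. u i = 0))"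
  show "u = w"
  proof (rule ccontr)
    assume ne: "u \<noteq> w"
    then have "zero_tail u" using u w(1) unfolding zero_tail_def by blast
    moreover have "zero_tail w" using u ne w(2) by blast
    ultimately show False
      using two_expansions[OF q w(1), of u] u ne not_zero_and_top_tail[OF q] by metis
  qed
qed

lemma digit_word_represents:
  assumes q: "q \<ge> 2" and x: "x \<in> {0..1}"
  shows "digit_word q x \<in> full_shift q" "val q (digit_word q x) = x"
proof -
  obtain w where w: "w \<in> full_shift q" "val q w = x" using ex_expansion[OF q x] .
  have "\<exists>u. u \<in> full_shift q \<and> val q u = x \<and> digit_word q x = u"
  proof (cases "\<exists>v. v \<in> full_shift q \<and> val q v = x \<and> v \<noteq> w")
    case True
    then obtain v where "v \<in> full_shift q" "val q v = x" "v \<noteq> w" by blast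
    then obtain u where "u \<in> full_shift q" "val q u = x" "zero_tail u"
      using two_expansions[OF q w(1), of v] w by metis
    then show ?thesis using digit_word_eqI[OF q, of u] by blast
  next
    case False
    then show ?thesis using digit_word_eqI[OF q w(1)] w by blast
  qed
  then show "digit_word q x \<in> full_shift q" "val q (digit_word q x) = x" by auto
qed

lemma digit_word_val:
  assumes q: "q \<ge> 2" and w: "w \<in> full_shift q" "\<not> top_tail q w"
  shows "digit_word q (val q w) = w"
  using two_expansions[OF q _ w(1)] w(2) by (intro digit_word_eqI[OF q w(1)]) metis

lemma psi_iterate_val:
  assumes q: "q \<ge> 2" and w: "w \<in> full_shift q" "\<not> top_tail q w"
  shows "(psi q ^^ k) (val q w) = val q (\<lambda>j. w (j + k))"
proof (induction k)
  case (Suc k)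
  have Sk: "(\<lambda>j. w (j + Suc k)) \<in> full_shift q" using w(1) by (rule shift_in_full_shift)
  have "val q (\<lambda>j. w (j + Suc k)) \<noteq> 1"
  proof
    assume "val q (\<lambda>j. w (j + Suc k)) = 1"
    then have "w (j + Suc k) = q - 1" for j using val_eq_1[OF q Sk] by blast
    then have "\<forall>i\<ge>Suc k. w i = q - 1" by (metis le_add_diff_inverse2)
    then show False using w(2) unfolding top_tail_def by blast
  qed
  then have b: "0 \<le> val q (\<lambda>j. w (j + Suc k))" "val q (\<lambda>j. w (j + Suc k)) < 1"
    using val_nonneg[OF q Sk] val_le_1[OF q Sk] by auto
  have eq: "real q * val q (\<lambda>j. w (j + k)) = real (w k) + val q (\<lambda>j. w (j + Suc k))"
    using val_Suc[OF q shift_in_full_shift[OF w(1)], of k] by simp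
  have "\<lfloor>real q * val q (\<lambda>j. w (j + k))\<rfloor> = int (w k)"
    unfolding eq using b by linarith
  then have "psi q (val q (\<lambda>j. w (j + k))) = val q (\<lambda>j. w (j + Suc k))"
    unfolding psi_def eq by simp
  then show ?case using Suc by simp
qed simp

section \<open>Hausdorff measure of sets of values\<close>

lemma card_nat_set_spread:
  fixes T :: "nat set"
  assumes "\<And>k l. k \<in> T \<Longrightarrow> l \<in> T \<Longrightarrow> l \<le> k + d"
  shows "finite T \<and> card T \<le> d + 1"
proof (cases "T = {}")
  case False
  define m where "m = (LEAST k. k \<in> T)"
  obtain k where "k \<in> T" using False by blast
  then have "m \<in> T" unfolding m_def by (rule LeastI)
  moreover have "m \<le> l" if "l \<in> T" for l unfolding m_def using that by (rule Least_le)
  ultimately have sub: "T \<subseteq> {m..m + d}" using assms by (meson atLeastAtMost_iff subsetI)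
  then show ?thesis using card_mono[OF _ sub] finite_subset[OF sub] by simp
qed simp

text \<open>The values of the words with a given prefix of length \<open>n\<close> lie in an interval
\<open>[k / q ^ n, (k + 1) / q ^ n]\<close>, and the integer \<open>k\<close> determines the prefix. A set of diameter at
most \<open>1 / q ^ n\<close> meets such intervals for at most three consecutive values of \<open>k\<close>.\<close>

lemma card_prefixes_small_set:
  assumes q: "q \<ge> 2" and U: "bounded U" "diameter U \<le> 1 / real q ^ n"
  shows "card (prefixes (full_shift q \<inter> val q -` U) n) \<le> 3"
proof -
  define S where "S = full_shift q \<inter> val q -` U"
  define T where "T = (\<lambda>w. prefix_num q w n) ` S"
  have "prefix_num q v n \<le> prefix_num q w n + 2" if "w \<in> S" "v \<in> S" for w v
  proof -
    have wv: "w \<in> full_shift q" "v \<in> full_shift q" "val q w \<in> U" "val q v \<in> U"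
      using that by (auto simp: S_def)
    have "\<bar>val q v - val q w\<bar> \<le> 1 / real q ^ n"
      using diameter_bounded_bound[OF U(1) wv(4,3)] U(2) by (simp add: dist_real_def)
    then have "val q v \<le> val q w + 1 / real q ^ n" by linarith
    then have "real q ^ n * val q v \<le> real q ^ n * (val q w + 1 / real q ^ n)"
      by (intro mult_left_mono) auto
    also have "\<dots> = real q ^ n * val q w + 1" using q by (simp add: distrib_left)
    finally have "real (prefix_num q v n) \<le> real (prefix_num q w n) + 2"
      using val_bounds(1)[OF q wv(2), of n] val_bounds(2)[OF q wv(1), of n] by linarith
    then show ?thesis by linarith
  qed
  then have T: "finite T \<and> card T \<le> 2 + 1"
    by (intro card_nat_set_spread) (auto simp: T_def)
  \<comment> \<open>the integer part \<open>k\<close> determines the prefix, so prefixes are no more numerous than integers\<close>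
  define g where "g k = map (SOME w. w \<in> S \<and> prefix_num q w n = k) [0..<n]" for k
  have "map w [0..<n] = g (prefix_num q w n)" if "w \<in> S" for w
  proof -
    define v where "v = (SOME v. v \<in> S \<and> prefix_num q v n = prefix_num q w n)"
    have "v \<in> S \<and> prefix_num q v n = prefix_num q w n"
      unfolding v_def by (rule someI[of _ w]) (simp add: that)
    then show ?thesis
      unfolding g_def v_def[symmetric] using that by (intro prefix_num_inj) (auto simp: S_def)
  qed
  then have "prefixes S n \<subseteq> g ` T" unfolding prefixes_def T_def by auto
  then have "card (prefixes S n) \<le> card T" using T by (intro surj_card_le) auto
  then show ?thesis using T unfolding S_def by simp
qed

lemma diam_power_finite: "diam_power s U < top"
  unfolding diam_power_def by simp

text \<open>The length \<open>n\<close> for which cylinders match a set \<open>U\<close> in size, so that the weight of a cylinder is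
comparable to the \<open>s\<close>-th power of the diameter. The error \<open>\<epsilon>\<close> takes care of sets with a single
point, which have no scale of their own.\<close>

lemma scale_of_set:
  assumes q: "q \<ge> 2" and s: "0 \<le> s" and \<epsilon>: "0 < \<epsilon>"
    and U: "U \<noteq> {}" "bounded U" "diameter U \<le> 1"
  shows "\<exists>n. diameter U \<le> 1 / real q ^ n
    \<and> (real q powr -s) ^ n \<le> real q powr s * enn2real (diam_power s U) + \<epsilon>"
proof (cases "s = 0")
  case True
  then show ?thesis using U q \<epsilon> by (intro exI[of _ 0]) (simp add: diam_power_def)
next
  case False
  then have s0: "0 < s" using s by simp
  have d: "enn2real (diam_power s U) = diameter U powr s"
    using U False by (simp add: diam_power_def)
  have pow: "(real q powr -s) ^ n = (1 / real q ^ n) powr s" for n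
    using q by (simp add: powr_minus powr_divide powr_power powr_realpow[symmetric] powr_powr
        power_inverse inverse_eq_divide mult.commute)
  show ?thesis
  proof (cases "diameter U = 0")
    case True
    have "real q powr -s < 1" using q s0 by (simp add: powr_less_one)
    then obtain n where "(real q powr -s) ^ n < \<epsilon>" using real_arch_pow_inv[OF \<epsilon>] by blast
    moreover have "0 \<le> real q powr s * enn2real (diam_power s U)" by simp
    ultimately have "(real q powr -s) ^ n \<le> real q powr s * enn2real (diam_power s U) + \<epsilon>"
      by linarith
    then show ?thesis using True by (intro exI[of _ n]) simp
  next
    case False
    then have d0: "0 < diameter U" using diameter_ge_0[OF U(2)] by simp
    have "\<exists>n. (1 / real q) ^ n < diameter U" using q d0 by (intro real_arch_pow_inv) auto
    then have ex: "\<exists>n. 1 / real q ^ n < diameter U" by (simp add: power_one_over)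
    \<comment> \<open>the scale \<open>n\<close> is the last one not below the diameter; \<open>m\<close> is the next\<close>
    define m where "m = (LEAST n. 1 / real q ^ n < diameter U)"
    have m: "1 / real q ^ m < diameter U" unfolding m_def using ex by (rule LeastI_ex)
    then have "m \<noteq> 0" using U(3) by (cases m) auto
    then obtain n where n: "m = Suc n" using not0_implies_Suc by blast
    have "\<not> 1 / real q ^ n < diameter U"
      using not_less_Least[of n "\<lambda>n. 1 / real q ^ n < diameter U"] n unfolding m_def by simp
    moreover have "(real q powr -s) ^ n = real q powr s * (real q powr -s) ^ m"
      using q by (simp add: n powr_minus)
    moreover have "(real q powr -s) ^ m \<le> diameter U powr s"
      unfolding pow using m s0 by (intro powr_mono2) auto
    ultimately show ?thesis
      using d \<epsilon> by (intro exI[of _ n]) (smt (verit) mult_left_mono powr_ge_zero)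
  qed
qed

text \<open>Each set of a cover of the line is traded for at most three cylinders of its own scale. This loses a
factor \<open>3 * q powr s\<close>, and the cylinders obey the lower bound of \<open>countable_cover_weight\<close>. The
negligible sets \<open>Y i\<close> make room for the countably many words that are not digit words of their
values.\<close>

lemma premeasure_lower_bound:
  assumes q: "q \<ge> 2" and s: "0 \<le> s"
    and X: "shift_invariant X" "X \<subseteq> full_shift q" "compact X"
    and growth: "\<And>n. 1 \<le> real (card (prefixes X n)) * (real q powr -s) ^ n"
    and small: "\<And>i. small_weight (real q powr -s) (Y i)"
    and A: "val q ` (X - (\<Union>i::nat. Y i)) \<subseteq> A"
  shows "ennreal (1 / (6 * real q powr s)) \<le> hausdorff_premeasure s 1 A"
  unfolding hausdorff_premeasure_def
proof (intro INF_greatest)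
  fix U :: "nat \<Rightarrow> real set"
  assume "U \<in> {U. A \<subseteq> (\<Union>i. U i) \<and> (\<forall>i. bounded (U i) \<and> diameter (U i) \<le> 1)}"
  then have U: "A \<subseteq> (\<Union>i. U i)" "\<And>i. bounded (U i)" "\<And>i. diameter (U i) \<le> 1" by auto
  define r where "r = real q powr -s"
  have r: "0 < r" using q by (simp add: r_def)
  have qs: "0 < real q powr s" using q by simp
  define c where "c = 1 / (6 * real q powr s)"
  show "ennreal (1 / (6 * real q powr s)) \<le> (\<Sum>i. diam_power s (U i))"
  proof (rule ccontr)
    assume "\<not> ?thesis"
    then have S_less: "(\<Sum>i. diam_power s (U i)) < ennreal c" by (simp add: c_def)
    define S where "S = enn2real (\<Sum>i. diam_power s (U i))"
    have S_eq: "(\<Sum>i. diam_power s (U i)) = ennreal S"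
      using S_less unfolding S_def by (metis ennreal_enn2real less_top top.extremum_strict order_less_trans ennreal_less_top)
    have S: "0 \<le> S" "S < c"
      using S_less unfolding S_eq by (auto simp: S_def ennreal_less_iff)
    define d where "d i = enn2real (diam_power s (U i))" for i
    have dS: "(\<Sum>i<N. d i) \<le> S" for N
    proof -
      have "ennreal (\<Sum>i<N. d i) = (\<Sum>i<N. diam_power s (U i))"
        unfolding d_def
        by (subst sum_ennreal[symmetric]) (simp_all add: ennreal_enn2real diam_power_finite)
      also have "\<dots> \<le> ennreal S" unfolding S_eq[symmetric] by (intro sum_le_suminf) auto
      finally show ?thesis using S(1) by simp
    qed
    \<comment> \<open>the errors have total at most 1/6, and \<open>c\<close> bounds the main term by 1/6: three times their sum stays below 1\<close>
    define \<epsilon> where "\<epsilon> i = 1 / 12 * (1 / 2 :: real) ^ i" for i :: nat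
    have \<epsilon>: "(\<Sum>i<N. \<epsilon> i) \<le> 1 / 6" for N
      unfolding \<epsilon>_def sum_distrib_left[symmetric] by (simp add: sum_gp_strict)
    have "\<exists>n. U i \<noteq> {} \<longrightarrow> diameter (U i) \<le> 1 / real q ^ n \<and> r ^ n \<le> real q powr s * d i + \<epsilon> i" for i
      using scale_of_set[OF q s, of "\<epsilon> i" "U i"] U(2,3) unfolding r_def d_def \<epsilon>_def
      by (cases "U i = {}") auto
    then obtain n where n: "\<And>i. U i \<noteq> {} \<Longrightarrow> diameter (U i) \<le> 1 / real q ^ n i"
        "\<And>i. U i \<noteq> {} \<Longrightarrow> r ^ n i \<le> real q powr s * d i + \<epsilon> i"
      by metis
    define V where "V i = prefixes (full_shift q \<inter> val q -` U i) (n i)" for i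
    have finV: "finite (V i)" for i unfolding V_def by (intro finite_prefixes[of _ q]) auto
    have wV: "(\<Sum>u\<in>V i. r ^ length u) \<le> 3 * (real q powr s * d i + \<epsilon> i)" for i
    proof (cases "U i = {}")
      case True
      then have "V i = {}" by (simp add: V_def prefixes_def)
      moreover have "0 \<le> real q powr s * d i + \<epsilon> i"
        unfolding d_def \<epsilon>_def by (intro add_nonneg_nonneg mult_nonneg_nonneg) auto
      ultimately show ?thesis by simp
    next
      case False
      have "(\<Sum>u\<in>V i. r ^ length u) = (\<Sum>u\<in>V i. r ^ n i)"
        unfolding V_def by (intro sum.cong) (auto simp: prefixes_def)
      also have "\<dots> = real (card (V i)) * r ^ n i" by simp
      also have "\<dots> \<le> 3 * r ^ n i"
        using card_prefixes_small_set[OF q U(2) n(1)[OF False]] r unfolding V_def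
        by (intro mult_right_mono) auto
      also have "\<dots> \<le> 3 * (real q powr s * d i + \<epsilon> i)"
        using n(2)[OF False] by (rule mult_left_mono) simp
      finally show ?thesis .
    qed
    have cover: "X \<subseteq> (\<Union>i. (\<Union>u\<in>V i. cylinder u) \<union> Y i)"
    proof
      fix w assume w: "w \<in> X"
      show "w \<in> (\<Union>i. (\<Union>u\<in>V i. cylinder u) \<union> Y i)"
      proof (cases "w \<in> (\<Union>i. Y i)")
        case False
        then have "val q w \<in> A" using w A by blast
        then obtain i where "val q w \<in> U i" using U(1) by blast
        then have "map w [0..<n i] \<in> V i" using w X(2) unfolding V_def prefixes_def by auto
        moreover have "w \<in> cylinder (map w [0..<n i])" by (simp add: cylinder_def)
        ultimately show ?thesis by blast
      qed blast
    qed
    define \<theta> where "\<theta> = 3 * (real q powr s * S + 1 / 6)"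
    have "real q powr s * S < real q powr s * c" using S(2) qs by (intro mult_strict_left_mono)
    also have "\<dots> = 1 / 6" using qs by (simp add: c_def)
    finally have "\<theta> < 1" unfolding \<theta>_def by simp
    then obtain N where N: "\<theta> < (\<Sum>i<N. \<Sum>u\<in>V i. r ^ length u)"
      using countable_cover_weight[OF X r _ finV _ cover] growth small unfolding r_def by blast
    have "(\<Sum>i<N. \<Sum>u\<in>V i. r ^ length u) \<le> (\<Sum>i<N. 3 * (real q powr s * d i + \<epsilon> i))"
      by (intro sum_mono wV)
    also have "\<dots> = 3 * (real q powr s * (\<Sum>i<N. d i) + (\<Sum>i<N. \<epsilon> i))"
      by (simp add: sum.distrib sum_distrib_left)
    also have "\<dots> \<le> \<theta>"
      unfolding \<theta>_def using dS[of N] \<epsilon>[of N] qs by (intro mult_left_mono add_mono) auto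
    finally show False using N by simp
  qed
qed

lemma hausdorff_premeasure_antimono:
  assumes "\<delta> \<le> \<delta>'"
  shows "hausdorff_premeasure s \<delta>' A \<le> hausdorff_premeasure s \<delta> A"
  unfolding hausdorff_premeasure_def using assms by (intro INF_superset_mono) (auto intro: order_trans)

lemma premeasure_le_measure:
  assumes "0 < \<delta>"
  shows "hausdorff_premeasure s \<delta> A \<le> hausdorff_measure s A"
  unfolding hausdorff_measure_def using assms by (intro SUP_upper) auto

lemma premeasure_exponent_antimono:
  assumes "0 \<le> t" "t \<le> s"
  shows "hausdorff_premeasure s 1 A \<le> hausdorff_premeasure t 1 A"
proof -
  have le: "diam_power s U \<le> diam_power t U" if "bounded U" "diameter U \<le> 1" for U :: "'a set"
    using that assms diameter_ge_0[OF that(1)] powr_mono'[of t s "diameter U"]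
    by (auto simp: diam_power_def powr_le_one_le intro!: ennreal_leI powr_le1 simp flip: ennreal_1)
  show ?thesis
    unfolding hausdorff_premeasure_def
  proof (rule INF_mono)
    fix U assume U: "U \<in> {U. A \<subseteq> (\<Union>i. U i) \<and> (\<forall>i :: nat. bounded (U i) \<and> diameter (U i) \<le> 1)}"
    have "(\<Sum>i. diam_power s (U i)) \<le> (\<Sum>i. diam_power t (U i))"
      using U by (intro suminf_le le) auto
    then show "\<exists>V\<in>{U. A \<subseteq> (\<Union>i. U i) \<and> (\<forall>i. bounded (U i) \<and> diameter (U i) \<le> 1)}.
        (\<Sum>i. diam_power s (V i)) \<le> (\<Sum>i. diam_power t (U i))"
      using U by (rule bexI)
  qed
qed

lemma premeasure_finite_cover:
  assumes F: "finite F" "A \<subseteq> \<Union>F" "\<And>U. U \<in> F \<Longrightarrow> bounded U \<and> diameter U \<le> \<delta>"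
    and \<delta>: "0 < \<delta>" and s: "0 \<le> s"
  shows "hausdorff_premeasure s \<delta> A \<le> ennreal (real (card F) * \<delta> powr s)"
proof -
  obtain g where g: "bij_betw g {0..<card F} F" using ex_bij_betw_nat_finite[OF F(1)] by blast
  then have gF: "g ` {0..<card F} = F" by (simp add: bij_betw_def)
  define U where "U i = (if i < card F then g i else {})" for i
  have UF: "U i \<in> F \<or> U i = {}" for i using gF unfolding U_def by auto
  have "A \<subseteq> (\<Union>i. U i)"
  proof
    fix x assume "x \<in> A"
    then obtain V where "V \<in> F" "x \<in> V" using F(2) by blast
    then have "V \<in> g ` {0..<card F}" by (simp only: gF)
    then obtain i where "i < card F" "x \<in> g i" using \<open>x \<in> V\<close> by (elim imageE) simp
    then have "x \<in> U i" by (simp add: U_def)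
    then show "x \<in> (\<Union>i. U i)" by blast
  qed
  moreover have U: "bounded (U i) \<and> diameter (U i) \<le> \<delta>" for i
    using UF[of i] F(3)[of "U i"] \<delta> by (elim disjE) simp_all
  ultimately have "hausdorff_premeasure s \<delta> A \<le> (\<Sum>i. diam_power s (U i))"
    unfolding hausdorff_premeasure_def by (intro INF_lower) auto
  also have "\<dots> = (\<Sum>i<card F. diam_power s (U i))"
    by (intro suminf_finite) (auto simp: U_def diam_power_def)
  also have "\<dots> \<le> (\<Sum>i<card F. ennreal (\<delta> powr s))"
  proof (rule sum_mono)
    fix i
    show "diam_power s (U i) \<le> ennreal (\<delta> powr s)"
      using U[of i] \<delta> s diameter_ge_0[of "U i"]
      by (auto simp: diam_power_def intro!: ennreal_leI powr_mono2)
  qed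
  also have "\<dots> = ennreal (real (card F) * \<delta> powr s)"
    by (simp add: ennreal_mult ennreal_of_nat_eq_real_of_nat)
  finally show ?thesis .
qed

lemma premeasure_0_ge_1:
  assumes "A \<noteq> {}"
  shows "1 \<le> hausdorff_premeasure 0 1 A"
  unfolding hausdorff_premeasure_def
proof (intro INF_greatest)
  fix U :: "nat \<Rightarrow> 'a set"
  assume "U \<in> {U. A \<subseteq> (\<Union>i. U i) \<and> (\<forall>i. bounded (U i) \<and> diameter (U i) \<le> 1)}"
  then obtain i where "U i \<noteq> {}" using assms by blast
  then have "1 = (\<Sum>j\<in>{i}. diam_power 0 (U j))" by (simp add: diam_power_def)
  also have "\<dots> \<le> (\<Sum>j. diam_power 0 (U j))" by (intro sum_le_suminf) auto
  finally show "1 \<le> (\<Sum>j. diam_power 0 (U j))" .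
qed

lemma hausdorff_dim_ge:
  assumes "0 < hausdorff_premeasure s 1 A" "0 \<le> s"
  shows "ereal s \<le> hausdorff_dim A"
  unfolding hausdorff_dim_def
proof (intro Inf_greatest)
  fix x assume "x \<in> {ereal s |s. 0 \<le> s \<and> hausdorff_measure s A = 0}"
  then obtain t where t: "x = ereal t" "0 \<le> t" "hausdorff_measure t A = 0" by blast
  have "s \<le> t"
  proof (rule ccontr)
    assume "\<not> s \<le> t"
    then have "hausdorff_premeasure s 1 A \<le> hausdorff_premeasure t 1 A"
      using t(2) by (intro premeasure_exponent_antimono) auto
    also have "\<dots> \<le> hausdorff_measure t A" by (intro premeasure_le_measure) simp
    finally show False using t(3) assms(1) by simp
  qed
  then show "ereal s \<le> x" by (simp add: t)
qed

section \<open>Box dimension\<close>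

definition totally_bdd :: "'a::metric_space set \<Rightarrow> bool" where
  "totally_bdd A \<longleftrightarrow>
     (\<forall>\<delta>>0. \<exists>F. finite F \<and> A \<subseteq> \<Union>F \<and> (\<forall>U\<in>F. bounded U \<and> diameter U \<le> \<delta>))"

lemma covering_number_attained:
  assumes "totally_bdd A" "0 < \<delta>"
  obtains F where "finite F" "card F = covering_number \<delta> A" "A \<subseteq> \<Union>F"
    "\<And>U. U \<in> F \<Longrightarrow> bounded U \<and> diameter U \<le> \<delta>"
proof -
  let ?P = "\<lambda>n. \<exists>F. finite F \<and> card F = n \<and> A \<subseteq> \<Union>F \<and> (\<forall>U\<in>F. bounded U \<and> diameter U \<le> \<delta>)"
  obtain G where "finite G \<and> A \<subseteq> \<Union>G \<and> (\<forall>U\<in>G. bounded U \<and> diameter U \<le> \<delta>)"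
    using assms(1)[unfolded totally_bdd_def, rule_format, OF assms(2)] by (elim exE)
  then have "?P (card G)" by (intro exI[of _ G]) simp
  then have "?P (covering_number \<delta> A)"
    unfolding covering_number_def by (rule LeastI[where P = ?P])
  then show thesis using that by blast
qed

lemma covering_number_le_card:
  assumes "finite F" "A \<subseteq> \<Union>F" "\<And>U. U \<in> F \<Longrightarrow> bounded U \<and> diameter U \<le> \<delta>"
  shows "covering_number \<delta> A \<le> card F"
  unfolding covering_number_def by (rule Least_le) (use assms in blast)

lemma premeasure_le_covering_number:
  assumes "totally_bdd A" "0 < \<delta>" "0 \<le> s"
  shows "hausdorff_premeasure s \<delta> A \<le> ennreal (real (covering_number \<delta> A) * \<delta> powr s)"
  using assms by (metis covering_number_attained premeasure_finite_cover)

lemma neg_ln_at_top: "LIM \<delta> at_right 0. - ln \<delta> :> (at_top :: real filter)"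
  using ln_at_0 by (simp add: filterlim_uminus_at_bot)

lemma const_over_neg_ln_tendsto: "((\<lambda>\<delta>. c / - ln \<delta>) \<longlongrightarrow> (0::real)) (at_right 0)"
  by (intro tendsto_divide_0[OF tendsto_const] filterlim_at_top_imp_at_infinity neg_ln_at_top)

lemma eventually_unit_interval: "\<forall>\<^sub>F \<delta> in at_right (0::real). 0 < \<delta> \<and> \<delta> < 1"
  using eventually_at_right_real[of 0 1] by simp

text \<open>A cover by \<open>N\<close> sets of diameter at most \<open>\<delta>\<close> shows that \<open>N * \<delta> powr s\<close> is at least the
premeasure, hence at least a positive constant that does not depend on \<open>\<delta>\<close>.\<close>

lemma upper_box_dim_ge:
  assumes A: "totally_bdd A" and pos: "0 < hausdorff_premeasure s 1 A" and s: "0 \<le> s"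
  shows "ereal s \<le> upper_box_dim A"
proof -
  obtain c where c: "0 < c" "ennreal c \<le> hausdorff_premeasure s 1 A"
  proof (cases "hausdorff_premeasure s 1 A")
    case (real c)
    then show thesis using that[of c] pos by auto
  next
    case top
    then show thesis using that[of 1] by simp
  qed
  have "((\<lambda>\<delta>. s + ln c / - ln \<delta>) \<longlongrightarrow> s + 0) (at_right 0)"
    by (intro tendsto_add tendsto_const const_over_neg_ln_tendsto)
  then have "((\<lambda>\<delta>. ereal (s + ln c / - ln \<delta>)) \<longlongrightarrow> ereal s) (at_right 0)" by simp
  then have "ereal s = Limsup (at_right 0) (\<lambda>\<delta>. ereal (s + ln c / - ln \<delta>))"
    by (intro lim_imp_Limsup[symmetric]) simp
  also have "\<dots> \<le> upper_box_dim A"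
    unfolding upper_box_dim_def
  proof (rule Limsup_mono, rule eventually_mono[OF eventually_unit_interval])
    fix \<delta> :: real assume \<delta>: "0 < \<delta> \<and> \<delta> < 1"
    have "ennreal c \<le> hausdorff_premeasure s \<delta> A"
      using c(2) hausdorff_premeasure_antimono[of \<delta> 1 s A] \<delta> by auto
    also have "\<dots> \<le> ennreal (real (covering_number \<delta> A) * \<delta> powr s)"
      using \<delta> by (intro premeasure_le_covering_number A s) simp
    finally have le: "c \<le> real (covering_number \<delta> A) * \<delta> powr s"
      using \<delta> by (subst (asm) ennreal_le_iff) auto
    then have N: "0 < real (covering_number \<delta> A)" using c(1) \<delta> by (cases "covering_number \<delta> A = 0") auto
    have "ln c \<le> ln (real (covering_number \<delta> A) * \<delta> powr s)" using le c(1) by (intro ln_mono) auto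
    also have "\<dots> = ln (real (covering_number \<delta> A)) + s * ln \<delta>"
      using N \<delta> by (subst ln_mult) (auto simp: ln_powr)
    finally have "s * (- ln \<delta>) + ln c \<le> ln (real (covering_number \<delta> A))" by simp
    moreover have "0 < - ln \<delta>" using \<delta> by simp
    ultimately have "(s * (- ln \<delta>) + ln c) / (- ln \<delta>) \<le> ln (real (covering_number \<delta> A)) / - ln \<delta>"
      by (intro divide_right_mono) auto
    moreover have "(s * (- ln \<delta>) + ln c) / (- ln \<delta>) = s + ln c / - ln \<delta>"
      using \<open>0 < - ln \<delta>\<close> by (simp add: field_simps)
    ultimately show "ereal (s + ln c / - ln \<delta>) \<le> ereal (ln (real (covering_number \<delta> A)) / - ln \<delta>)"
      by simp
  qed
  finally show ?thesis .
qed

text \<open>For exponents above the upper box dimension, the economical covers by sets of diameter at most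
\<open>\<delta>\<close> have \<open>\<delta>\<close>-sums that tend to 0 with \<open>\<delta>\<close>.\<close>

lemma hausdorff_dim_le_upper_box_dim:
  assumes A: "totally_bdd A" and dim: "upper_box_dim A \<le> ereal s" and s: "0 \<le> s"
  shows "hausdorff_dim A \<le> ereal s"
proof (rule ereal_le_epsilon2)
  fix e :: real assume e: "0 < e"
  have "upper_box_dim A < ereal (s + e / 2)" using dim e by (auto intro: order_le_less_trans)
  then have "\<forall>\<^sub>F \<delta> in at_right 0. ereal (ln (real (covering_number \<delta> A)) / - ln \<delta>) < ereal (s + e / 2)"
    unfolding upper_box_dim_def by (rule Limsup_lessD)
  then have ev: "\<forall>\<^sub>F \<delta> in at_right 0. hausdorff_premeasure (s + e) \<delta> A \<le> ennreal (\<delta> powr (e / 2))"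
    using eventually_unit_interval
  proof eventually_elim
    case (elim \<delta>)
    let ?N = "real (covering_number \<delta> A)"
    have ln: "0 < - ln \<delta>" using elim by simp
    have "?N \<le> \<delta> powr (- (s + e / 2))"
    proof (cases "?N = 0")
      case False
      then have N0: "0 < ?N" by simp
      have "ln ?N < (s + e / 2) * (- ln \<delta>)" 
        using elim(1) unfolding less_ereal.simps pos_divide_less_eq[OF ln] .
      then have "exp (ln ?N) \<le> exp ((s + e / 2) * (- ln \<delta>))" by simp
      then show ?thesis using N0 elim by (simp add: powr_def algebra_simps)
    qed simp
    then have "?N * \<delta> powr (s + e) \<le> \<delta> powr (- (s + e / 2)) * \<delta> powr (s + e)"
      by (intro mult_right_mono) auto
    also have "\<dots> = \<delta> powr (e / 2)" by (simp flip: powr_add)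
    finally have "ennreal (?N * \<delta> powr (s + e)) \<le> ennreal (\<delta> powr (e / 2))" by (intro ennreal_leI)
    with premeasure_le_covering_number[OF A, of \<delta> "s + e"] show ?case
      using elim s e by (auto intro: order_trans)
  qed
  have "((\<lambda>\<delta>. \<delta> powr (e / 2)) \<longlongrightarrow> 0 powr (e / 2)) (at_right (0::real))"
    using e by (intro tendsto_powr' tendsto_intros) (auto simp: eventually_at_filter)
  then have lim: "((\<lambda>\<delta>. ennreal (\<delta> powr (e / 2))) \<longlongrightarrow> 0) (at_right 0)"
    by (auto dest: tendsto_ennrealI)
  have "hausdorff_premeasure (s + e) \<delta>0 A \<le> 0" if "0 < \<delta>0" for \<delta>0
  proof (rule tendsto_lowerbound[OF lim])
    have "\<forall>\<^sub>F \<delta> in at_right 0. \<delta> < \<delta>0"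
      using eventually_at_right_real[OF that] by (rule eventually_mono) simp
    with ev show "\<forall>\<^sub>F \<delta> in at_right 0. hausdorff_premeasure (s + e) \<delta>0 A \<le> ennreal (\<delta> powr (e / 2))"
    proof eventually_elim
      case (elim \<delta>)
      then show ?case using hausdorff_premeasure_antimono[of \<delta> \<delta>0 "s + e" A] by auto
    qed
  qed simp
  then have "hausdorff_measure (s + e) A \<le> 0"
    unfolding hausdorff_measure_def by (intro SUP_least) simp
  then show "hausdorff_dim A \<le> ereal s + ereal e"
    unfolding hausdorff_dim_def using s e by (intro Inf_lower) auto
qed

lemma value_cover:
  assumes q: "q \<ge> 2" and X: "X \<subseteq> full_shift q" and A: "A \<subseteq> val q ` X" and \<delta>: "1 / real q ^ n \<le> \<delta>"
  obtains F where "finite F" "card F \<le> card (prefixes X n)" "A \<subseteq> \<Union>F"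
    "\<And>U. U \<in> F \<Longrightarrow> bounded U \<and> diameter U \<le> \<delta>"
proof
  define F where "F = (\<lambda>u. val q ` (X \<inter> {w. map w [0..<n] = u})) ` prefixes X n"
  show "finite F" "card F \<le> card (prefixes X n)"
    unfolding F_def using finite_prefixes[OF X, of n] by (auto intro: card_image_le)
  show "A \<subseteq> \<Union>F"
  proof
    fix x assume "x \<in> A"
    then obtain w where "w \<in> X" "x = val q w" using A by blast
    then show "x \<in> \<Union>F" unfolding F_def prefixes_def by blast
  qed
  fix U assume "U \<in> F"
  then obtain u where U: "U = val q ` (X \<inter> {w. map w [0..<n] = u})" unfolding F_def by blast
  have "val q w - val q v \<le> 1 / real q ^ n"
    if "w \<in> X" "v \<in> X" "map w [0..<n] = map v [0..<n]" for w v
  proof -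
    have "real q ^ n * val q w \<le> real (prefix_num q w n) + 1"
      using val_bounds(2)[OF q] that X by blast
    moreover have "real (prefix_num q w n) \<le> real q ^ n * val q v"
      using val_bounds(1)[OF q] that X prefix_num_cong[OF that(3), of q] by auto
    ultimately have "real q ^ n * (val q w - val q v) \<le> 1" by (simp add: right_diff_distrib)
    then show ?thesis using q by (simp add: field_simps)
  qed
  then have "\<bar>x - y\<bar> \<le> \<delta>" if "x \<in> U" "y \<in> U" for x y
    using that \<delta> unfolding U by (smt (verit) Int_iff imageE mem_Collect_eq)
  moreover have "0 \<le> \<delta>" using \<delta> order_trans[of 0 "1 / real q ^ n" \<delta>] by simp
  moreover have "U \<subseteq> {0..1}" unfolding U using X val_nonneg[OF q] val_le_1[OF q] by auto
  then have "bounded U" using bounded_closed_interval bounded_subset by blast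
  ultimately show "bounded U \<and> diameter U \<le> \<delta>" by (auto intro: diameter_le)
qed

lemma totally_bdd_values:
  assumes q: "q \<ge> 2" and X: "X \<subseteq> full_shift q" and A: "A \<subseteq> val q ` X"
  shows "totally_bdd A"
  unfolding totally_bdd_def
proof (intro allI impI)
  fix \<delta> :: real assume "0 < \<delta>"
  then have "\<exists>n. (1 / real q) ^ n < \<delta>" using q by (intro real_arch_pow_inv) auto
  then obtain n where "1 / real q ^ n \<le> \<delta>" by (auto simp: power_one_over intro: less_imp_le)
  then show "\<exists>F. finite F \<and> A \<subseteq> \<Union>F \<and> (\<forall>U\<in>F. bounded U \<and> diameter U \<le> \<delta>)"
    using value_cover[OF q X A] by metis
qed

text \<open>At scale \<open>\<delta>\<close> the prefixes of length \<open>n = \<lceil>- ln \<delta> / ln q\<rceil>\<close> suffice, and their number is at most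
\<open>exp (k * n)\<close> for any \<open>k\<close> above \<open>h\<close>. Rounding up costs the term \<open>k / - ln \<delta>\<close>, which
vanishes in the limit.\<close>

lemma upper_box_dim_values_le:
  assumes q: "q \<ge> 2" and X: "X \<subseteq> full_shift q" and A: "A \<subseteq> val q ` X" "A \<noteq> {}"
    and lim: "(\<lambda>n. 1 / real n * ln (real (card (prefixes X n)))) \<longlonglongrightarrow> h" and h: "0 \<le> h"
  shows "upper_box_dim A \<le> ereal (h / ln (real q))"
proof (rule ereal_le_epsilon2)
  fix e :: real assume e: "0 < e"
  have lnq: "0 < ln (real q)" using q by simp
  define k where "k = h + e * ln (real q)"
  have k: "h < k" "0 < k" using e h lnq by (auto simp: k_def add_nonneg_pos)
  have "\<forall>\<^sub>F n in sequentially. 1 / real n * ln (real (card (prefixes X n))) < k"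
    using lim k(1) by (rule order_tendstoD)
  then obtain n0 where n0: "\<And>n. n \<ge> n0 \<Longrightarrow> 1 / real n * ln (real (card (prefixes X n))) < k"
    unfolding eventually_sequentially by blast
  have "\<forall>\<^sub>F \<delta> in at_right 0. (real n0 + 1) * ln (real q) \<le> - ln \<delta>"
    using neg_ln_at_top unfolding filterlim_at_top by blast
  then have "\<forall>\<^sub>F \<delta> in at_right 0. ereal (ln (real (covering_number \<delta> A)) / - ln \<delta>)
      \<le> ereal (k / ln (real q) + k / - ln \<delta>)"
    using eventually_unit_interval
  proof eventually_elim
    case (elim \<delta>)
    define x where "x = - ln \<delta>"
    have x: "0 < x" using elim by (simp add: x_def)
    define n where "n = nat \<lceil>x / ln (real q)\<rceil>"
    have n: "x / ln (real q) \<le> real n" "real n \<le> x / ln (real q) + 1"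
      unfolding n_def using x lnq by (auto simp: of_nat_nat ceiling_le_iff intro: less_imp_le)
    have "real n0 + 1 \<le> x / ln (real q)" using elim lnq by (simp add: x_def field_simps)
    then have nn: "n \<ge> n0" "0 < n" using n(1) by linarith+
    have "x \<le> real n * ln (real q)" using n(1) lnq by (simp add: field_simps)
    then have "exp (- (real n * ln (real q))) \<le> exp (ln \<delta>)" by (simp add: x_def)
    then have "1 / real q ^ n \<le> \<delta>"
      using q elim by (simp add: exp_minus exp_of_nat_mult inverse_eq_divide)
    then obtain F where F: "finite F" "card F \<le> card (prefixes X n)" "A \<subseteq> \<Union>F"
        "\<And>U. U \<in> F \<Longrightarrow> bounded U \<and> diameter U \<le> \<delta>"
      using value_cover[OF q X A(1)] by metis
    have "covering_number \<delta> A \<le> card (prefixes X n)"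
      using covering_number_le_card[OF F(1,3,4)] F(2) by simp
    moreover have "0 < covering_number \<delta> A"
    proof (rule ccontr)
      assume "\<not> 0 < covering_number \<delta> A"
      moreover obtain G where "finite G" "card G = covering_number \<delta> A" "A \<subseteq> \<Union>G"
        using covering_number_attained[OF totally_bdd_values[OF q X A(1)]] elim by metis
      ultimately show False using A(2) by auto
    qed
    ultimately have "ln (real (covering_number \<delta> A)) \<le> ln (real (card (prefixes X n)))"
      by (intro ln_mono) auto
    also have "\<dots> \<le> real n * k" using n0[OF nn(1)] nn(2) by (simp add: field_simps)
    also have "\<dots> \<le> (x / ln (real q) + 1) * k" using n(2) k(2) by (intro mult_right_mono) auto
    finally have "ln (real (covering_number \<delta> A)) / x \<le> (x / ln (real q) + 1) * k / x"
      using x by (intro divide_right_mono) auto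
    also have "\<dots> = k / ln (real q) + k / x" using x by (simp add: field_simps)
    finally show ?case by (simp add: x_def)
  qed
  then have "upper_box_dim A \<le> Limsup (at_right 0) (\<lambda>\<delta>. ereal (k / ln (real q) + k / - ln \<delta>))"
    unfolding upper_box_dim_def by (rule Limsup_mono)
  also have "\<dots> = ereal (k / ln (real q))"
  proof (rule lim_imp_Limsup)
    have "((\<lambda>\<delta>. k / ln (real q) + k / - ln \<delta>) \<longlongrightarrow> k / ln (real q) + 0) (at_right 0)"
      by (intro tendsto_add tendsto_const const_over_neg_ln_tendsto)
    then show "((\<lambda>\<delta>. ereal (k / ln (real q) + k / - ln \<delta>)) \<longlongrightarrow> ereal (k / ln (real q))) (at_right 0)"
      by simp
  qed simp
  also have "\<dots> = ereal (h / ln (real q)) + ereal e"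
    using lnq by (simp add: k_def field_simps)
  finally show "upper_box_dim A \<le> ereal (h / ln (real q)) + ereal e" .
qed

section \<open>Words of bounded complexity\<close>

lemma W_subset_full_shift: "W q f \<subseteq> full_shift q"
  unfolding W_def full_shift_def by auto

lemma shift_invariant_W: "shift_invariant (W q f)"
  unfolding shift_invariant_def
proof
  fix w assume w: "w \<in> W q f"
  then have fs: "w \<in> full_shift q" using W_subset_full_shift by blast
  have "complexity (\<lambda>j. w (Suc j)) n \<le> complexity w n" for n
    unfolding complexity_def using finite_factors[OF fs] factors_shift_subset by (rule card_mono)
  moreover have "(\<lambda>j. w (Suc j)) \<in> full_shift q" using shift_in_full_shift[OF fs, of 1] by simp
  ultimately show "(\<lambda>j. w (Suc j)) \<in> W q f"
    using w unfolding W_def full_shift_def by (force intro: order_trans[OF of_nat_mono])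
qed

lemma closed_full_shift: "closed (full_shift q)"
proof -
  have "full_shift q = (\<Inter>i. (\<lambda>w. w i) -` alphabet q)"
    unfolding full_shift_def by auto
  also have "closed \<dots>"
    by (intro closed_INT ballI closed_vimage continuous_on_product_coordinates)
      (simp add: closed_def open_discrete)
  finally show ?thesis .
qed

text \<open>All factors of length \<open>n\<close> of \<open>w\<close> already occur in a finite part of \<open>w\<close>, hence also in any word
that agrees with \<open>w\<close> there.\<close>

lemma complexity_semicontinuous:
  assumes "w \<in> full_shift q"
  obtains N where "\<And>v. v \<in> full_shift q \<Longrightarrow> map v [0..<N] = map w [0..<N] \<Longrightarrow> complexity w n \<le> complexity v n"
proof -
  have "factors w n \<subseteq> range (\<lambda>i. map w [i..<i + n])" unfolding factors_def by auto
  then obtain I where I: "finite I" "factors w n = (\<lambda>i. map w [i..<i + n]) ` I"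
    using finite_subset_image[OF finite_factors[OF assms]] by (metis subset_UNIV)
  obtain M where M: "I \<subseteq> {..<M}" using I(1) finite_nat_iff_bounded by blast
  show thesis
  proof (rule that)
    fix v assume v: "v \<in> full_shift q" and eq: "map v [0..<M + n] = map w [0..<M + n]"
    have "v j = w j" if "j < M + n" for j using eq that by simp
    then have same: "map w [i..<i + n] = map v [i..<i + n]" if "i \<in> I" for i using that M by auto
    have "factors w n \<subseteq> factors v n"
      unfolding I(2)
    proof (rule image_subsetI)
      fix i assume "i \<in> I"
      then have "map w [i..<i + n] = map v [i..<i + n]" by (rule same)
      then show "map w [i..<i + n] \<in> factors v n" unfolding factors_def by blast
    qed
    then show "complexity w n \<le> complexity v n"
      unfolding complexity_def using finite_factors[OF v] by (intro card_mono)
  qed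
qed

text \<open>By \<open>complexity_semicontinuous\<close> a violation \<open>f n < complexity w n\<close> persists on a whole cylinder
around \<open>w\<close>.\<close>

lemma closed_W: "closed (W q f)"
proof -
  \<comment> \<open>the union of all cylinders that miss \<open>W q f\<close> is open\<close>
  define G where "G = \<Union>{cylinder u |u. cylinder u \<inter> W q f = {}}"
  have "W q f = full_shift q \<inter> - G"
  proof
    show "W q f \<subseteq> full_shift q \<inter> - G" using W_subset_full_shift unfolding G_def by blast
    show "full_shift q \<inter> - G \<subseteq> W q f"
    proof
      fix w assume w: "w \<in> full_shift q \<inter> - G"
      show "w \<in> W q f"
      proof (rule ccontr)
        assume "w \<notin> W q f"
        then obtain n where n: "f n < real (complexity w n)"
          using w unfolding W_def full_shift_def by (auto simp: not_le)
        obtain N where N: "\<And>v. v \<in> full_shift q \<Longrightarrow> map v [0..<N] = map w [0..<N]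
            \<Longrightarrow> complexity w n \<le> complexity v n"
          using complexity_semicontinuous[of w q n] w by blast
        have "v \<notin> W q f" if "v \<in> cylinder (map w [0..<N])" for v
        proof
          assume v: "v \<in> W q f"
          then have "complexity w n \<le> complexity v n"
            using that W_subset_full_shift by (intro N) (auto simp: cylinder_def)
          moreover have "real (complexity v n) \<le> f n" using v unfolding W_def by blast
          ultimately show False using n by linarith
        qed
        then have "cylinder (map w [0..<N]) \<subseteq> G" unfolding G_def by blast
        moreover have "w \<in> cylinder (map w [0..<N])" by (simp add: cylinder_def)
        ultimately show False using w by blast
      qed
    qed
  qed
  moreover have "open G" unfolding G_def using open_cylinder by (intro open_Union) auto
  ultimately show ?thesis using closed_full_shift by (simp add: closed_Int closed_Compl)
qed

lemma compact_closed_subset_full_shift: "closed X \<Longrightarrow> X \<subseteq> full_shift q \<Longrightarrow> compact X"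
  using compact_Int_closed[OF compact_full_shift, of X q] by (simp add: Int_absorb1)

lemma entropy_tendsto:
  assumes "w \<in> full_shift q"
  shows "(\<lambda>n. 1 / real n * ln (real (complexity w n))) \<longlonglongrightarrow> entropy w"
proof -
  have "shift_orbit w \<subseteq> full_shift q" using assms by (auto simp: shift_orbit_def shift_in_full_shift)
  moreover have "shift_orbit w \<noteq> {}" by (simp add: shift_orbit_def)
  ultimately obtain h where "(\<lambda>n. 1 / real n * ln (real (card (prefixes (shift_orbit w) n)))) \<longlonglongrightarrow> h"
    using language_growth[OF shift_invariant_orbit] by metis
  then have "(\<lambda>n. 1 / real n * ln (real (complexity w n))) \<longlonglongrightarrow> h"
    unfolding complexity_def factors_eq_prefixes .
  then show ?thesis unfolding entropy_def by (simp add: limI)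
qed

lemma growth_iff: "1 \<le> c * exp (- h) ^ n \<longleftrightarrow> exp (real n * h) \<le> (c :: real)"
proof -
  have eq: "exp (- h) ^ n = inverse (exp (real n * h))"
    by (simp add: exp_minus power_inverse exp_of_nat_mult)
  show ?thesis unfolding eq by (simp add: field_simps)
qed

text \<open>The supremum of the entropies over \<open>W q f\<close> is the topological entropy of the subshift
\<open>W q f\<close>: no point can exceed it, because its factors are prefixes of points of the subshift, and
the point from \<open>ex_maximal_complexity\<close> attains it.\<close>

lemma word_entropy_growth:
  assumes "W q f \<noteq> {}"
  shows "(\<lambda>n. 1 / real n * ln (real (card (prefixes (W q f) n)))) \<longlonglongrightarrow> word_entropy q f"
    and "exp (real n * word_entropy q f) \<le> real (card (prefixes (W q f) n))"
    and "0 \<le> word_entropy q f"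
    and "\<exists>w\<in>W q f. \<forall>n. exp (real n * word_entropy q f) \<le> real (complexity w n)"
proof -
  note X = shift_invariant_W[of q f] W_subset_full_shift[of q f]
  obtain h where lim: "(\<lambda>n. 1 / real n * ln (real (card (prefixes (W q f) n)))) \<longlonglongrightarrow> h"
    and ge: "\<And>n. exp (real n * h) \<le> real (card (prefixes (W q f) n))" and h0: "0 \<le> h"
    using language_growth[OF X assms] by blast
  obtain w where w: "w \<in> W q f" "\<And>n. exp (real n * h) \<le> real (complexity w n)"
    using ex_maximal_complexity[OF X compact_closed_subset_full_shift[OF closed_W X(2)], of "exp (- h)"] ge
    unfolding growth_iff by auto
  have le: "entropy v \<le> h" if v: "v \<in> W q f" for v
  proof (rule LIMSEQ_le[OF entropy_tendsto lim])
    show fv: "v \<in> full_shift q" using v X(2) by blast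
    have pos: "0 < complexity v n" for n
      using finite_factors[OF fv, of n] by (auto simp: complexity_def card_gt_0_iff factors_def)
    have "complexity v n \<le> card (prefixes (W q f) n)" for n
      unfolding complexity_def factors_eq_prefixes
      by (intro card_mono finite_prefixes[OF X(2)] prefixes_mono shift_orbit_subset X(1) v)
    then have "ln (real (complexity v n)) \<le> ln (real (card (prefixes (W q f) n)))" for n
      using pos[of n] by (intro ln_mono) auto
    then show "\<exists>N. \<forall>n\<ge>N. 1 / real n * ln (real (complexity v n))
        \<le> 1 / real n * ln (real (card (prefixes (W q f) n)))"
      by (intro exI[of _ 0] allI impI mult_left_mono) simp_all
  qed
  have "h \<le> entropy w"
  proof (rule LIMSEQ_le_const[OF entropy_tendsto])
    show "w \<in> full_shift q" using w(1) X(2) by blast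
    have "h \<le> 1 / real n * ln (real (complexity w n))" if "n \<ge> 1" for n
    proof -
      have "ln (exp (real n * h)) \<le> ln (real (complexity w n))"
        using w(2)[of n] by (intro ln_mono) auto
      then show ?thesis using that by (simp add: field_simps)
    qed
    then show "\<exists>N. \<forall>n\<ge>N. h \<le> 1 / real n * ln (real (complexity w n))" by blast
  qed
  then have "entropy w = h" using le[OF w(1)] by simp
  then have "word_entropy q f = h"
    unfolding word_entropy_def using w(1) le by (intro cSup_eq_maximum) auto
  then show "(\<lambda>n. 1 / real n * ln (real (card (prefixes (W q f) n)))) \<longlonglongrightarrow> word_entropy q f"
    "exp (real n * word_entropy q f) \<le> real (card (prefixes (W q f) n))" "0 \<le> word_entropy q f"
    "\<exists>w\<in>W q f. \<forall>n. exp (real n * word_entropy q f) \<le> real (complexity w n)"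
    using lim ge h0 w by auto
qed

section \<open>The set of numbers whose digits have bounded complexity\<close>

lemma C_subset_values:
  assumes "q \<ge> 2"
  shows "C q f \<subseteq> val q ` W q f"
proof
  fix x assume "x \<in> C q f"
  then have "digit_word q x \<in> W q f" "val q (digit_word q x) = x"
    using digit_word_represents[OF assms] unfolding C_def by auto
  then show "x \<in> val q ` W q f" by (metis image_eqI)
qed

text \<open>A value can fall outside \<open>C q f\<close> only when its chosen expansion is the other one, which forces the
given word to end with the digit \<open>q - 1\<close>.\<close>

lemma values_in_C:
  assumes q: "q \<ge> 2" and w: "w \<in> W q f" "\<not> top_tail q w"
  shows "val q w \<in> C q f"
proof -
  have fs: "w \<in> full_shift q" using w(1) W_subset_full_shift by blast
  then show ?thesis
    unfolding C_def using w digit_word_val[OF q fs w(2)] val_nonneg[OF q fs] val_le_1[OF q fs] by simp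
qed

lemma countable_top_tail: "countable {w \<in> full_shift q. top_tail q w}"
proof -
  define g where "g u i = (if i < length u then u ! i else q - 1)" for u :: "nat list" and i
  have "{w \<in> full_shift q. top_tail q w} \<subseteq> range g"
  proof
    fix w assume "w \<in> {w \<in> full_shift q. top_tail q w}"
    then obtain N where "\<forall>i\<ge>N. w i = q - 1" unfolding top_tail_def by blast
    then have "w = g (map w [0..<N])" by (auto simp: g_def)
    then show "w \<in> range g" by blast
  qed
  then show ?thesis by (rule countable_subset) simp
qed

lemma finite_orbit_top_tail:
  assumes "top_tail q w"
  shows "finite (shift_orbit w)"
proof -
  obtain N where N: "\<forall>i\<ge>N. w i = q - 1" using assms unfolding top_tail_def by blast
  have "shift_orbit w \<subseteq> insert (\<lambda>_. q - 1) ((\<lambda>k j. w (j + k)) ` {..<N})"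
  proof
    fix v assume "v \<in> shift_orbit w"
    then obtain k where k: "v = (\<lambda>j. w (j + k))" unfolding shift_orbit_def by blast
    show "v \<in> insert (\<lambda>_. q - 1) ((\<lambda>k j. w (j + k)) ` {..<N})"
      using N by (cases "k < N") (auto simp: k)
  qed
  then show ?thesis by (rule finite_subset) simp
qed

text \<open>An eventually constant word has a finite orbit and therefore bounded complexity.\<close>

lemma not_top_tail_if_exponential_complexity:
  assumes "0 < h" "\<And>n. exp (real n * h) \<le> real (complexity w n)"
  shows "\<not> top_tail q w"
proof
  assume "top_tail q w"
  then have fin: "finite (shift_orbit w)" by (rule finite_orbit_top_tail)
  have "real n * h \<le> real (card (shift_orbit w))" for n
  proof -
    have "real n * h \<le> exp (real n * h)" using exp_ge_add_one_self[of "real n * h"] by linarith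
    also have "\<dots> \<le> real (card (prefixes (shift_orbit w) n))"
      using assms(2)[of n] unfolding complexity_def factors_eq_prefixes .
    also have "\<dots> \<le> real (card (shift_orbit w))"
      unfolding prefixes_def using card_image_le[OF fin] by simp
    finally show ?thesis .
  qed
  moreover obtain n where "real (card (shift_orbit w)) < real n * h"
    using reals_Archimedean3[OF assms(1)] by blast
  ultimately show False by (meson not_le)
qed

text \<open>Every complexity is at least 1, which is the complexity of a constant word. In entropy 0 this word
serves as the witness, where discarding countably many points would not be harmless.\<close>

lemma zero_word:
  assumes q: "q \<ge> 2" and "W q f \<noteq> {}"
  shows "(\<lambda>_. 0) \<in> W q f" "\<not> top_tail q (\<lambda>_. 0)"
proof -
  obtain v where v: "v \<in> W q f" using assms(2) by blast
  have "complexity (\<lambda>_. 0::nat) n \<le> complexity v n" for n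
  proof -
    have "factors (\<lambda>_. 0::nat) n = {map (\<lambda>_. 0) [0..<n]}"
      unfolding factors_def by (auto simp: map_replicate_const)
    moreover have "finite (factors v n)" by (rule finite_factors[OF subsetD[OF W_subset_full_shift v]])
    moreover have "factors v n \<noteq> {}" by (auto simp: factors_def)
    ultimately show ?thesis by (simp add: complexity_def Suc_le_eq card_gt_0_iff)
  qed
  then show "(\<lambda>_. 0) \<in> W q f"
    using v q unfolding W_def by (force simp: alphabet_def intro: order_trans[OF of_nat_mono])
  show "\<not> top_tail q (\<lambda>_. 0)" using q unfolding top_tail_def by auto
qed

text \<open>A word of maximal entropy whose value has it as digit word. Positive entropy alone excludes a tail of
digits \<open>q - 1\<close>; in entropy 0 the word with constant digit 0 is taken.\<close>

lemma ex_word_of_full_entropy: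
  assumes q: "q \<ge> 2" and ne: "W q f \<noteq> {}"
  obtains w where "w \<in> W q f" "\<not> top_tail q w"
    "\<And>n. exp (real n * word_entropy q f) \<le> real (complexity w n)"
proof (cases "word_entropy q f = 0")
  case True
  have "0 < complexity (\<lambda>_. 0::nat) n" for n
    using finite_factors[of "\<lambda>_. 0::nat" q n] q
    by (auto simp: complexity_def card_gt_0_iff factors_def full_shift_def alphabet_def)
  then have "exp (real n * word_entropy q f) \<le> real (complexity (\<lambda>_. 0::nat) n)" for n
    using True by (simp add: Suc_le_eq)
  then show thesis using zero_word[OF q ne] that by blast
next
  case False
  then have "0 < word_entropy q f" using word_entropy_growth(3)[OF ne] by simp
  then show thesis
    using word_entropy_growth(4)[OF ne] not_top_tail_if_exponential_complexity that by blast
qed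

lemma powr_neg_entropy:
  assumes "q \<ge> 2"
  shows "real q powr - (h / ln (real q)) = exp (- h)"
  using assms by (simp add: powr_def)

text \<open>For positive entropy the words ending with \<open>q - 1\<close> form a countable, hence negligible, part of
\<open>W q f\<close>. For entropy 0 the exponent is 0 and it is enough that \<open>C q f\<close> is not empty.\<close>

lemma premeasure_C_pos:
  assumes q: "q \<ge> 2" and ne: "W q f \<noteq> {}"
  shows "0 < hausdorff_premeasure (word_entropy q f / ln (real q)) 1 (C q f)"
proof (cases "word_entropy q f = 0")
  case True
  have "C q f \<noteq> {}" using values_in_C[OF q] zero_word[OF q ne] by blast
  then have "1 \<le> hausdorff_premeasure 0 1 (C q f)" by (rule premeasure_0_ge_1)
  then show ?thesis using True by (simp add: less_le_trans[OF zero_less_one])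
next
  case False
  let ?s = "word_entropy q f / ln (real q)"
  have h: "0 < word_entropy q f" using False word_entropy_growth(3)[OF ne] by simp
  then have s: "0 \<le> ?s" using q by simp
  define Z where "Z = {w \<in> full_shift q. top_tail q w}"
  have "(\<lambda>_. q - 1) \<in> Z"
    using q by (auto simp: Z_def full_shift_def alphabet_def top_tail_def)
  then have Z: "range (from_nat_into Z) = Z"
    using countable_top_tail unfolding Z_def by (intro range_from_nat_into) auto
  have "ennreal (1 / (6 * real q powr ?s)) \<le> hausdorff_premeasure ?s 1 (C q f)"
  proof (rule premeasure_lower_bound[OF q s shift_invariant_W W_subset_full_shift])
    show "compact (W q f)"
      by (rule compact_closed_subset_full_shift[OF closed_W W_subset_full_shift])
    show "1 \<le> real (card (prefixes (W q f) n)) * (real q powr - ?s) ^ n" for n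
      unfolding powr_neg_entropy[OF q] growth_iff by (rule word_entropy_growth(2)[OF ne])
    show "small_weight (real q powr - ?s) {from_nat_into Z i}" for i
      unfolding powr_neg_entropy[OF q] using h by (intro small_weight_singleton) auto
    have UZ: "(\<Union>i. {from_nat_into Z i}) = Z" using Z by (simp add: UNION_singleton_eq_range)
    have "val q w \<in> C q f" if "w \<in> W q f - Z" for w
      using that W_subset_full_shift by (intro values_in_C[OF q]) (auto simp: Z_def)
    then show "val q ` (W q f - (\<Union>i. {from_nat_into Z i})) \<subseteq> C q f"
      unfolding UZ by (rule image_subsetI)
  qed
  moreover have "0 < ennreal (1 / (6 * real q powr ?s))" using q by simp
  ultimately show ?thesis by (rule less_le_trans[rotated])
qed

lemma shift_continuous: "continuous_on UNIV (\<lambda>(w :: nat \<Rightarrow> nat) j. w (Suc j))"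
  by (intro continuous_on_coordinatewise_then_product continuous_on_product_coordinates)

text \<open>The orbit closure of \<open>w\<close> in the full shift is itself a compact subshift, and its language contains
all factors of \<open>w\<close>; \<open>val q\<close> maps it continuously into the closure of the orbit of \<open>val q w\<close>
under \<open>psi q\<close>.\<close>

lemma orbit_closure_premeasure_pos:
  assumes q: "q \<ge> 2" and w: "w \<in> full_shift q" "\<not> top_tail q w"
    and h: "0 \<le> h" and growth: "\<And>n. exp (real n * h) \<le> real (complexity w n)"
  shows "0 < hausdorff_premeasure (h / ln (real q)) 1 (closure {(psi q ^^ k) (val q w) |k. True})"
proof -
  let ?s = "h / ln (real q)"
  let ?O = "{(psi q ^^ k) (val q w) |k. True}"
  define X where "X = closure (shift_orbit w)"
  have "shift_orbit w \<subseteq> full_shift q" using w(1) by (auto simp: shift_orbit_def shift_in_full_shift)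
  then have sub: "X \<subseteq> full_shift q" unfolding X_def using closed_full_shift by (rule closure_minimal)
  have cpt: "compact X" unfolding X_def
    by (rule compact_closed_subset_full_shift[OF closed_closure sub[unfolded X_def]])
  have "(\<lambda>v j. v (Suc j)) ` X \<subseteq> X"
    unfolding X_def
  proof (rule image_closure_subset)
    show "continuous_on (closure (shift_orbit w)) (\<lambda>v j. v (Suc j))"
      using shift_continuous by (rule continuous_on_subset) simp
    show "(\<lambda>v j. v (Suc j)) ` shift_orbit w \<subseteq> closure (shift_orbit w)"
      using shift_invariant_orbit[of w] closure_subset unfolding shift_invariant_def by blast
  qed simp
  then have inv: "shift_invariant X" unfolding shift_invariant_def by blast
  have "val q ` X \<subseteq> closure ?O"
    unfolding X_def
  proof (rule image_closure_subset)
    show "continuous_on (closure (shift_orbit w)) (val q)"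
      using val_continuous_on[OF q] sub unfolding X_def by (rule continuous_on_subset)
    have "val q ` shift_orbit w = ?O"
      unfolding shift_orbit_def psi_iterate_val[OF q w] by auto
    then show "val q ` shift_orbit w \<subseteq> closure ?O" using closure_subset by simp
  qed simp
  then have img: "val q ` (X - (\<Union>i::nat. {})) \<subseteq> closure ?O" by simp
  have "ennreal (1 / (6 * real q powr ?s)) \<le> hausdorff_premeasure ?s 1 (closure ?O)"
  proof (rule premeasure_lower_bound[OF q _ inv sub cpt _ _ img])
    show "0 \<le> ?s" using h q by simp
    show "1 \<le> real (card (prefixes X n)) * (real q powr - ?s) ^ n" for n
      unfolding powr_neg_entropy[OF q] growth_iff
    proof (rule order_trans[OF growth])
      show "real (complexity w n) \<le> real (card (prefixes X n))"
        unfolding complexity_def factors_eq_prefixes X_def of_nat_le_iff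
        by (intro card_mono prefixes_mono closure_subset finite_prefixes[OF sub[unfolded X_def]])
    qed
    show "small_weight (real q powr - ?s) {}"
      unfolding small_weight_def by (intro allI impI exI[of _ "{}"]) simp
  qed
  moreover have "0 < ennreal (1 / (6 * real q powr ?s))" using q by simp
  ultimately show ?thesis by (rule less_le_trans[rotated])
qed

theorem theorem5p1:
  fixes q :: nat and f :: "nat \<Rightarrow> real"
  assumes "q \<ge> 2"
    and "\<And>n. f n > 0"
    and "W q f \<noteq> {}"
  shows "hausdorff_dim (C q f) = ereal (word_entropy q f / ln (real q))
    \<and> (upper_box_dim (C q f) = ereal (word_entropy q f / ln (real q))
       \<and> hausdorff_measure (word_entropy q f / ln (real q)) (C q f) > 0)
    \<and> (\<exists>x\<in>C q f.
         hausdorff_measure (word_entropy q f / ln (real q))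
           (closure {(psi q ^^ k) x | k. True}) > 0)"
proof -
  note q = assms(1) and ne = assms(3)
  let ?s = "word_entropy q f / ln (real q)"
  have h: "0 \<le> word_entropy q f" by (rule word_entropy_growth(3)[OF ne])
  then have s: "0 \<le> ?s" using q by simp
  have pos: "0 < hausdorff_premeasure ?s 1 (C q f)" by (rule premeasure_C_pos[OF q ne])
  note C_values = W_subset_full_shift C_subset_values[OF q]
  have tb: "totally_bdd (C q f)" by (rule totally_bdd_values[OF q C_values])
  have "C q f \<noteq> {}" using values_in_C[OF q] zero_word[OF q ne] by blast
  then have box_le: "upper_box_dim (C q f) \<le> ereal ?s"
    using word_entropy_growth(1)[OF ne] h by (rule upper_box_dim_values_le[OF q C_values])
  have "upper_box_dim (C q f) = ereal ?s"
    using box_le upper_box_dim_ge[OF tb pos s] by (rule antisym)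
  moreover have "hausdorff_dim (C q f) = ereal ?s"
    using hausdorff_dim_le_upper_box_dim[OF tb box_le s] hausdorff_dim_ge[OF pos s] by (rule antisym)
  moreover have "0 < hausdorff_measure ?s (C q f)"
    using pos premeasure_le_measure[of 1 ?s "C q f"] by (simp add: less_le_trans)
  moreover obtain w where w: "w \<in> W q f" "\<not> top_tail q w"
      "\<And>n. exp (real n * word_entropy q f) \<le> real (complexity w n)"
    using ex_word_of_full_entropy[OF q ne] by blast
  have "0 < hausdorff_premeasure ?s 1 (closure {(psi q ^^ k) (val q w) |k. True})"
    using w W_subset_full_shift h by (intro orbit_closure_premeasure_pos[OF q]) auto
  then have "0 < hausdorff_measure ?s (closure {(psi q ^^ k) (val q w) |k. True})"
    by (rule less_le_trans) (simp add: premeasure_le_measure)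
  then have "\<exists>x\<in>C q f. 0 < hausdorff_measure ?s (closure {(psi q ^^ k) x |k. True})"
    using values_in_C[OF q w(1,2)] by blast
  ultimately show ?thesis by blast
qed

end
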